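(* Let $\mathfrak{F}$ be a subgroup-closed saturated superradical formation containing all nilpotent groups, and let $G$ be a finite soluble group with $G\notin\mathfrak{F}$. Then the following statements are equivalent. $(1)$ Every primary cyclic subgroup of $G$ is $\mathfrak{F}$-subnormal in $G$ or self-normalizing in $G$. $(2)$ Every non-abnormal subgroup of $G$ is $\mathfrak{F}$-subnormal in $G$ and belongs to $\mathfrak{F}$. $(3)$ $G=G'\rtimes\langle x\rangle$, where $\langle x\rangle$ is a Sylow $p$-subgroup of $G$ for some prime $p\in\pi(G)$ and a Carter subgroup of $G$, $G'=G^{\mathfrak{N}}$, and $G'\rtimes\langle x^p\rangle\in\mathfrak{F}$.
   Context: All groups are finite. $\pi(G)$ is the set of prime divisors of $|G|$; $G'$ is the derived subgroup of $G$; $A\rtimes B$ is the (internal) semidirect product of a normal subgroup $A$ and a subgroup $B$; $\mathfrak{N}$ is the class of all nilpotent groups. A primary subgroup is a subgroup of order $p^n$ for some prime $p$ and integer $n\geq 1$. A formation is a non-empty class of finite groups closed under isomorphisms, quotients and subdirect products. A formation $\mathfrak{F}$ is subgroup-closed if every subgroup of a group in $\mathfrak{F}$ is in $\mathfrak{F}$, and saturated if $G/\Phi(G)\in\mathfrak{F}$ implies $G\in\mathfrak{F}$, where $\Phi(G)$ is the Frattini subgroup. $G^{\mathfrak{F}}$ denotes the intersection of all normal subgroups $N$ of $G$ with $G/N\in\mathfrak{F}$; in particular $G^{\mathfrak{N}}$ is the nilpotent residual. A subgroup $H$ of $G$ is $\mathfrak{F}$-subnormal in $G$ if $H=G$ or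 there is a chain $H=H_0<H_1<\dots<H_n=G$ with each $H_{i-1}$ a maximal subgroup of $H_i$ and $H_i/(H_{i-1})_{H_i}\in\mathfrak{F}$ for all $i$, where $A_B=\bigcap_{b\in B}A^b$ is the core of $A$ in $B$. A normal-subgroup-closed formation $\mathfrak{F}$ is superradical if any group $G=AB$ belongs to $\mathfrak{F}$ whenever $A$ and $B$ are $\mathfrak{F}$-subnormal subgroups of $G$ that belong to $\mathfrak{F}$. A subgroup $H$ of $G$ is self-normalizing if $N_G(H)=H$; abnormal if $x\in\langle H,H^x\rangle$ for every $x\in G$; a Carter subgroup if it is nilpotent and self-normalizing. *)

theory Defs
  imports
    "HOL-Computational_Algebra.Primes"
    "HOL-Algebra.Group_Action"
    "HOL-Algebra.Elementary_Groups"
    "HOL-Algebra.Solvable_Groups"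
begin

text \<open>
  HOL has no quantification over types, so a class of finite groups is represented by its members
  whose carrier is a set of natural numbers. Every finite group is isomorphic to one of these, so
  isomorphism-closed classes of finite groups correspond exactly to isomorphism-closed sets of
  finite groups of type \<^typ>\<open>nat monoid\<close>. A group of any type belongs to the class iff it
  is isomorphic to a listed one.
\<close>

definition in_class :: "('a, 'b) monoid_scheme \<Rightarrow> nat monoid set \<Rightarrow> bool" where
  "in_class G F \<longleftrightarrow> group G \<and> (\<exists>K\<in>F. G \<cong> K)"

definition group_class :: "nat monoid set \<Rightarrow> bool" where
  "group_class F \<longleftrightarrow>
     (\<forall>G\<in>F. group G \<and> finite (carrier G)) \<and>
     (\<forall>G\<in>F. \<forall>K :: nat monoid. group K \<and> G \<cong> K \<longrightarrow> K \<in> F)"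

text \<open>
  Closure under subdirect products is stated for two factors. Any finite number of factors follows
  by iteration; the empty product, the trivial group, is a quotient of a member.
\<close>

definition formation :: "nat monoid set \<Rightarrow> bool" where
  "formation F \<longleftrightarrow>
     group_class F \<and> F \<noteq> {} \<and>
     (\<forall>G\<in>F. \<forall>N. N \<lhd> G \<longrightarrow> in_class (G Mod N) F) \<and>
     (\<forall>A\<in>F. \<forall>B\<in>F. \<forall>H. subgroup H (A \<times>\<times> B) \<and> fst ` H = carrier A \<and> snd ` H = carrier B
        \<longrightarrow> in_class ((A \<times>\<times> B)\<lparr>carrier := H\<rparr>) F)"

definition subgroup_closed :: "nat monoid set \<Rightarrow> bool" where
  "subgroup_closed F \<longleftrightarrow> (\<forall>G\<in>F. \<forall>H. subgroup H G \<longrightarrow> G\<lparr>carrier := H\<rparr> \<in> F)"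

definition normal_subgroup_closed :: "nat monoid set \<Rightarrow> bool" where
  "normal_subgroup_closed F \<longleftrightarrow> (\<forall>G\<in>F. \<forall>N. N \<lhd> G \<longrightarrow> G\<lparr>carrier := N\<rparr> \<in> F)"

definition maximal_subgroup :: "'a set \<Rightarrow> ('a, 'b) monoid_scheme \<Rightarrow> bool" where
  "maximal_subgroup M G \<longleftrightarrow>
     subgroup M G \<and> M \<noteq> carrier G \<and>
     (\<forall>K. subgroup K G \<and> M \<subseteq> K \<longrightarrow> K = M \<or> K = carrier G)"

text \<open>The trivial group has no maximal subgroups and is its own Frattini subgroup.\<close>

definition frattini :: "('a, 'b) monoid_scheme \<Rightarrow> 'a set" where
  "frattini G = carrier G \<inter> \<Inter>{M. maximal_subgroup M G}"

definition saturated :: "nat monoid set \<Rightarrow> bool" where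
  "saturated F \<longleftrightarrow>
     (\<forall>G :: nat monoid. group G \<and> finite (carrier G) \<and> in_class (G Mod frattini G) F \<longrightarrow> G \<in> F)"

definition residual :: "nat monoid set \<Rightarrow> ('a, 'b) monoid_scheme \<Rightarrow> 'a set" where
  "residual F G = \<Inter>{N. N \<lhd> G \<and> in_class (G Mod N) F}"

fun lower_central :: "('a, 'b) monoid_scheme \<Rightarrow> nat \<Rightarrow> 'a set" where
  "lower_central G 0 = carrier G"
| "lower_central G (Suc n) =
     generate G (\<Union>x\<in>lower_central G n. \<Union>y\<in>carrier G.
       {x \<otimes>\<^bsub>G\<^esub> y \<otimes>\<^bsub>G\<^esub> inv\<^bsub>G\<^esub> x \<otimes>\<^bsub>G\<^esub> inv\<^bsub>G\<^esub> y})"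

definition nilpotent_group :: "('a, 'b) monoid_scheme \<Rightarrow> bool" where
  "nilpotent_group G \<longleftrightarrow> group G \<and> (\<exists>n. lower_central G n = {\<one>\<^bsub>G\<^esub>})"

definition nilpotent_class :: "nat monoid set" where
  "nilpotent_class = {G. finite (carrier G) \<and> nilpotent_group G}"

definition conj_subgroup :: "('a, 'b) monoid_scheme \<Rightarrow> 'a set \<Rightarrow> 'a \<Rightarrow> 'a set" where
  "conj_subgroup G H x = inv\<^bsub>G\<^esub> x <#\<^bsub>G\<^esub> H #>\<^bsub>G\<^esub> x"

definition core_in :: "('a, 'b) monoid_scheme \<Rightarrow> 'a set \<Rightarrow> 'a set \<Rightarrow> 'a set" where
  "core_in G A B = (\<Inter>b\<in>B. conj_subgroup G A b)"

definition F_subnormal ::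
  "nat monoid set \<Rightarrow> 'a set \<Rightarrow> ('a, 'b) monoid_scheme \<Rightarrow> bool" where
  "F_subnormal F H G \<longleftrightarrow>
     H = carrier G \<or>
     (\<exists>(n :: nat) C. C 0 = H \<and> C n = carrier G \<and>
        (\<forall>i<n. maximal_subgroup (C i) (G\<lparr>carrier := C (Suc i)\<rparr>) \<and>
               in_class (G\<lparr>carrier := C (Suc i)\<rparr> Mod core_in G (C i) (C (Suc i))) F))"

definition superradical :: "nat monoid set \<Rightarrow> bool" where
  "superradical F \<longleftrightarrow>
     formation F \<and> normal_subgroup_closed F \<and>
     (\<forall>(G :: nat monoid) A B.
        group G \<and> finite (carrier G) \<and> subgroup A G \<and> subgroup B G \<and>
        carrier G = A <#>\<^bsub>G\<^esub> B \<and>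
        F_subnormal F A G \<and> F_subnormal F B G \<and>
        in_class (G\<lparr>carrier := A\<rparr>) F \<and> in_class (G\<lparr>carrier := B\<rparr>) F
        \<longrightarrow> G \<in> F)"

definition primary_subgroup :: "'a set \<Rightarrow> ('a, 'b) monoid_scheme \<Rightarrow> bool" where
  "primary_subgroup H G \<longleftrightarrow>
     subgroup H G \<and> (\<exists>(p :: nat) n. prime p \<and> 1 \<le> n \<and> card H = p ^ n)"

definition self_normalizing :: "'a set \<Rightarrow> ('a, 'b) monoid_scheme \<Rightarrow> bool" where
  "self_normalizing H G \<longleftrightarrow> subgroup H G \<and> normalizer G H = H"

definition abnormal :: "'a set \<Rightarrow> ('a, 'b) monoid_scheme \<Rightarrow> bool" where
  "abnormal H G \<longleftrightarrow>
     subgroup H G \<and> (\<forall>x\<in>carrier G. x \<in> generate G (H \<union> conj_subgroup G H x))"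

definition carter_subgroup :: "'a set \<Rightarrow> ('a, 'b) monoid_scheme \<Rightarrow> bool" where
  "carter_subgroup H G \<longleftrightarrow> nilpotent_group (G\<lparr>carrier := H\<rparr>) \<and> self_normalizing H G"

definition sylow_subgroup :: "nat \<Rightarrow> 'a set \<Rightarrow> ('a, 'b) monoid_scheme \<Rightarrow> bool" where
  "sylow_subgroup p P G \<longleftrightarrow>
     prime p \<and> subgroup P G \<and> card P = p ^ multiplicity p (order G)"

definition semidirect :: "('a, 'b) monoid_scheme \<Rightarrow> 'a set \<Rightarrow> 'a set \<Rightarrow> bool" where
  "semidirect G A B \<longleftrightarrow>
     A \<lhd> G \<and> subgroup B G \<and> carrier G = A <#>\<^bsub>G\<^esub> B \<and> A \<inter> B = {\<one>\<^bsub>G\<^esub>}"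

end

theory Submission
  imports Defs "HOL-Algebra.Sylow" "HOL-Algebra.Zassenhaus" "HOL-Algebra.Multiplicative_Group"
    "HOL-Algebra.Weak_Morphisms"
begin

text \<open>
  (1) to (3). Superradicality gives: if every primary cyclic subgroup of a soluble group \<open>S\<close> is
  \<open>F\<close>-subnormal, then \<open>S \<in> F\<close>. Indeed, by induction on the order one may assume that \<open>S\<close> is not
  abelian; take a maximal subgroup \<open>M\<close> containing \<open>S'\<close>, an element \<open>x \<notin> M\<close> of prime power
  order, and the last proper term \<open>K \<ge> \<langle>x\<rangle>\<close> of an \<open>F\<close>-subnormal chain from \<open>\<langle>x\<rangle>\<close>; then \<open>S = MK\<close>
  with both factors \<open>F\<close>-subnormal and, by induction, in \<open>F\<close>. As \<open>G \<notin> F\<close>, some primary cyclic \<open>P\<close> is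
  self-normalizing. It is a Sylow subgroup, it has a normal complement, which must be \<open>G'\<close>, and the
  same criterion applies to \<open>G'\<langle>x\<^sup>p\<rangle>\<close>, because any other self-normalizing primary cyclic subgroup also
  supplements \<open>G'\<close>.

  (3) to (2). Every overgroup of a conjugate of \<open>P\<close> is abnormal. A subgroup not contained in
  \<open>G'\<langle>x\<^sup>p\<rangle>\<close> contains an element whose order is divisible by \<open>|P|\<close>, hence contains a conjugate of \<open>P\<close>.

  (2) to (1). Abnormal subgroups are self-normalizing.
\<close>

subsection \<open>Sylow subgroups and abnormality\<close>

text \<open>The recurring device: a subgroup containing a self-normalizing p-subgroup
  \<open>P\<close> is abnormal, hence self-normalizing, and a normal self-normalizing subgroup is
  the whole group. This turns first \<open>K P\<close> for a normal \<open>K\<close> of order prime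
  to p, and then \<open>G' P\<close>, into \<open>G\<close>. The obstacle is the existence of
  \<open>K\<close>: one divides out the largest normal subgroup of order prime to p and shows that
  an abelian Sylow p-subgroup of the soluble quotient is normal. For G' = G^N, let G/M be nilpotent.
  Then \<open>M P\<close> is self-normalizing and contains a term of the lower central series.
  Normalizers grow along that series, so \<open>M P\<close> is \<open>G\<close> and G/M is abelian.
  A self-normalizing primary cyclic H inside G'<x^p> would give G = G'H inside G'<x^p>, which does
  not contain x. In (3) to (2) the chain runs from H through G'<x^p> to G: below G'<x^p> every step
  is legitimate because that group lies in \<open>F\<close>, and the upper step has an abelian
  quotient. Intersecting a chain with a subgroup destroys maximality of its links, so chains are
  handled through a coarser relation that is stable under intersection.\<close>

lemma (in group) group_actionI:
  assumes closed: "\<And>g x. \<lbrakk>g \<in> carrier G; x \<in> E\<rbrakk> \<Longrightarrow> \<phi> g x \<in> E"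
    and one: "\<And>x. x \<in> E \<Longrightarrow> \<phi> \<one> x = x"
    and mult: "\<And>g h x. \<lbrakk>g \<in> carrier G; h \<in> carrier G; x \<in> E\<rbrakk> \<Longrightarrow> \<phi> (g \<otimes> h) x = \<phi> g (\<phi> h x)"
  shows "group_action G E (\<lambda>g. \<lambda>x\<in>E. \<phi> g x)"
proof -
  \<comment> \<open>Members of \<open>BijGroup E\<close> are extensional, hence the restriction to
    \<open>E\<close>; the inverse bijection comes from \<open>inv g\<close>.\<close>
  have bij: "(\<lambda>x\<in>E. \<phi> g x) \<in> Bij E" if g: "g \<in> carrier G" for g
  proof -
    have "bij_betw (\<phi> g) E E"
    proof (rule bij_betwI[where g = "\<phi> (inv g)"])
      show "\<phi> g \<in> E \<rightarrow> E" "\<phi> (inv g) \<in> E \<rightarrow> E" using g closed by auto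
      show "\<phi> (inv g) (\<phi> g x) = x" if "x \<in> E" for x
        using mult[of "inv g" g x] g that one by simp
      show "\<phi> g (\<phi> (inv g) x) = x" if "x \<in> E" for x
        using mult[of g "inv g" x] g that one by simp
    qed
    then show ?thesis by (simp add: Bij_def cong: bij_betw_cong)
  qed
  show ?thesis
    unfolding group_action_def group_hom_def group_hom_axioms_def
  proof (intro conjI homI)
    show "group G" "group (BijGroup E)" by (auto simp: group_BijGroup)
    show "(\<lambda>x\<in>E. \<phi> g x) \<in> carrier (BijGroup E)" if "g \<in> carrier G" for g
      using bij[OF that] by (simp add: BijGroup_def)
    show "(\<lambda>x\<in>E. \<phi> (g \<otimes> h) x) = (\<lambda>x\<in>E. \<phi> g x) \<otimes>\<^bsub>BijGroup E\<^esub> (\<lambda>x\<in>E. \<phi> h x)"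
      if "g \<in> carrier G" "h \<in> carrier G" for g h
      using that bij closed mult by (auto simp: BijGroup_def compose_def restrict_def)
  qed
qed

text \<open>The points that are not fixed fall into orbits whose sizes divide p^k and differ from 1,
  hence are multiples of p. Only this part of the congruence modulo p is needed later.\<close>

lemma (in group_action) prime_dvd_card_fixed_points_iff:
  fixes p :: nat
  assumes p: "prime p" and ord: "order G = p ^ k" and fin: "finite E"
  shows "p dvd card {x \<in> E. \<forall>g\<in>carrier G. \<phi> g x = x} \<longleftrightarrow> p dvd card E"
proof -
  let ?F = "{x \<in> E. \<forall>g\<in>carrier G. \<phi> g x = x}"
  let ?C = "{A \<in> orbits G E \<phi>. card A \<noteq> 1}"
  have orbE: "\<Union>(orbits G E \<phi>) = E" by (rule orbits_coverture)
  have grp: "group G" using group_hom by (simp add: group_hom_def)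
  have sing: "orbit G \<phi> x = {x} \<longleftrightarrow> (\<forall>g\<in>carrier G. \<phi> g x = x)" if "x \<in> E" for x
    using orbit_refl[OF that] by (auto simp: orbit_def)
  have EF: "E - ?F = \<Union>?C"
  proof (intro equalityI subsetI)
    fix x assume x: "x \<in> E - ?F"
    then have xE: "x \<in> E" and nf: "\<not> (\<forall>g\<in>carrier G. \<phi> g x = x)" by simp_all
    then have "orbit G \<phi> x \<noteq> {x}" using sing by simp
    moreover have xo: "x \<in> orbit G \<phi> x" using xE by (rule orbit_refl)
    ultimately have "card (orbit G \<phi> x) \<noteq> 1" by (auto simp: card_1_singleton_iff)
    then show "x \<in> \<Union>?C" using xE xo unfolding orbits_def by blast
  next
    fix x assume "x \<in> \<Union>?C"
    then obtain A where A: "A \<in> orbits G E \<phi>" "card A \<noteq> 1" "x \<in> A" by auto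
    then have xE: "x \<in> E" using orbE by auto
    then have "orbit G \<phi> x \<in> orbits G E \<phi>" "x \<in> orbit G \<phi> x" using orbit_refl by (auto simp: orbits_def)
    then have "A = orbit G \<phi> x" using disjoint_union[OF A(1)] A(3) by blast
    then have "\<not> (\<forall>g\<in>carrier G. \<phi> g x = x)" using sing[OF xE] A(2) by auto
    then show "x \<in> E - ?F" using xE by simp
  qed
  have "p dvd card (\<Union>?C)"
  proof (rule dvd_partition)
    show "finite (\<Union>?C)" using fin unfolding EF[symmetric] by (rule finite_Diff)
    show "\<forall>A\<in>?C. p dvd card A"
    proof
      fix A assume A: "A \<in> ?C"
      then obtain x where x: "x \<in> E" "A = orbit G \<phi> x" by (auto simp: orbits_def)
      then have "card A dvd p ^ k" using orbit_stabilizer_theorem ord by (metis dvd_triv_left)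
      then obtain j where j: "card A = p ^ j" using p by (auto simp: divides_primepow_nat)
      with A show "p dvd card A" by (cases j) auto
    qed
    show "\<forall>A\<in>?C. \<forall>B\<in>?C. A \<noteq> B \<longrightarrow> A \<inter> B = {}"
      using disjoint_union by blast
  qed
  then have d: "p dvd card (E - ?F)" by (simp only: EF)
  have "card E = card ?F + card (E - ?F)"
    using card_Un_disjoint[of ?F "E - ?F"] fin by (simp add: Un_absorb1 Collect_subset)
  then show ?thesis using d by (simp only: dvd_add_left_iff)
qed

lemma (in group) prime_dvd_card_fixed_rcosets_iff:
  fixes p :: nat
  assumes fin: "finite (carrier G)" and p: "prime p"
    and Q: "subgroup Q G" "card Q = p ^ k" and H: "subgroup H G"
  shows "p dvd card {R \<in> rcosets H. \<forall>q\<in>Q. R #> q = R} \<longleftrightarrow> p dvd card (rcosets H)"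
proof -
  interpret Q: group "G\<lparr>carrier := Q\<rparr>" using Q(1) by (rule subgroup_imp_group)
  have sub: "R \<subseteq> carrier G" if "R \<in> rcosets H" for R
    using that rcosets_part_G[OF H] by auto
  have cl: "R #> g \<in> rcosets H" if g: "g \<in> carrier G" and R: "R \<in> rcosets H" for g R
  proof -
    obtain a where a: "a \<in> carrier G" "R = H #> a" using R by (auto simp: RCOSETS_def)
    then have "R #> g = H #> (a \<otimes> g)" using g H coset_mult_assoc subgroup.subset by blast
    then show ?thesis using a g rcosetsI H subgroup.subset by (metis m_closed)
  qed
  have QG: "Q \<subseteq> carrier G" using Q(1) subgroup.subset by auto
  \<comment> \<open>Right multiplication is a right action on the right cosets; the inverse makes it
    a left action.\<close>
  have "group_action (G\<lparr>carrier := Q\<rparr>) (rcosets H) (\<lambda>g. \<lambda>R\<in>rcosets H. R #> inv g)"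
  proof (rule Q.group_actionI)
    show "R #> inv g \<in> rcosets H" if "g \<in> carrier (G\<lparr>carrier := Q\<rparr>)" "R \<in> rcosets H" for g R
      using cl that QG by auto
    show "R #> inv \<one>\<^bsub>G\<lparr>carrier := Q\<rparr>\<^esub> = R" if "R \<in> rcosets H" for R
      using sub[OF that] by simp
    show "R #> inv (g \<otimes>\<^bsub>G\<lparr>carrier := Q\<rparr>\<^esub> h) = R #> inv h #> inv g"
      if "g \<in> carrier (G\<lparr>carrier := Q\<rparr>)" "h \<in> carrier (G\<lparr>carrier := Q\<rparr>)" "R \<in> rcosets H" for g h R
    proof -
      have "g \<in> carrier G" "h \<in> carrier G" using that QG by auto
      then show ?thesis using coset_mult_assoc[OF sub[OF that(3)], of "inv h" "inv g"] by (simp add: inv_mult_group)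
    qed
  qed
  then interpret A: group_action "G\<lparr>carrier := Q\<rparr>" "rcosets H" "\<lambda>g. \<lambda>R\<in>rcosets H. R #> inv g" .
  have "finite (rcosets H)" using fin rcosets_subset_PowG[OF H] finite_subset by auto
  then have "p dvd card {R \<in> rcosets H. \<forall>g\<in>Q. (\<lambda>R\<in>rcosets H. R #> inv g) R = R} \<longleftrightarrow> p dvd card (rcosets H)"
    using A.prime_dvd_card_fixed_points_iff[OF p, of k] Q by (simp add: order_def)
  \<comment> \<open>\<open>Q\<close> is closed under inverses, so the inverse does not change the
    fixed points.\<close>
  moreover have "{R \<in> rcosets H. \<forall>g\<in>Q. (\<lambda>R\<in>rcosets H. R #> inv g) R = R} = {R \<in> rcosets H. \<forall>q\<in>Q. R #> q = R}"
  proof -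
    have "R #> q = R" if "\<forall>q\<in>Q. R #> inv q = R" "q \<in> Q" for R q
      using bspec[OF that(1) subgroup.m_inv_closed[OF Q(1) that(2)]] inv_inv[of q] QG that(2) by auto
    then show ?thesis using subgroup.m_inv_closed[OF Q(1)] by auto
  qed
  ultimately show ?thesis by simp
qed

lemma (in group) rcoset_fixed_iff:
  assumes "subgroup H G" "g \<in> carrier G" "q \<in> carrier G"
  shows "(H #> g) #> q = H #> g \<longleftrightarrow> g \<otimes> q \<otimes> inv g \<in> H"
proof -
  have "(H #> g) #> q = H #> (g \<otimes> q)" using assms coset_mult_assoc subgroup.subset by blast
  moreover have "H #> (g \<otimes> q) = H #> g \<longleftrightarrow> g \<otimes> q \<in> H #> g"
    using assms by (metis m_closed rcos_self repr_independence)
  moreover have "g \<otimes> q \<in> H #> g \<longleftrightarrow> g \<otimes> q \<otimes> inv g \<in> H"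
    using assms by (metis m_closed is_group subgroup.rcos_module)
  ultimately show ?thesis by simp
qed

text \<open>The two conditions on \<open>n\<close> say that \<open>H\<close> contains a full p-part
  of \<open>G\<close>, that is, has index prime to p. So \<open>Q\<close> fixes some coset
  \<open>H #> g\<close>, which means that g Q g^-1 lies in \<open>H\<close>.\<close>

lemma (in group) p_subgroup_conjugate_into:
  fixes p :: nat
  assumes "finite (carrier G)" and "prime p"
    and Q: "subgroup Q G" "card Q = p ^ k" and H: "subgroup H G"
    and n: "p ^ n dvd card H" "\<not> p ^ Suc n dvd order G"
  obtains g where "g \<in> carrier G" "\<And>q. q \<in> Q \<Longrightarrow> g \<otimes> q \<otimes> inv g \<in> H"
proof -
  have "\<not> p dvd card (rcosets H)"
  proof
    assume "p dvd card (rcosets H)"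
    then have "p * p ^ n dvd card (rcosets H) * card H" using n(1) by (rule mult_dvd_mono)
    then show False using n(2) lagrange[OF H] by simp
  qed
  then have "\<not> p dvd card {R \<in> rcosets H. \<forall>q\<in>Q. R #> q = R}"
    using prime_dvd_card_fixed_rcosets_iff assms by blast
  then have "{R \<in> rcosets H. \<forall>q\<in>Q. R #> q = R} \<noteq> {}" by (metis card.empty dvd_0_right)
  then obtain g where "g \<in> carrier G" "\<forall>q\<in>Q. (H #> g) #> q = H #> g" by (auto simp: RCOSETS_def)
  then show ?thesis using that rcoset_fixed_iff[OF H] subgroup.mem_carrier[OF Q(1)] by blast
qed

text \<open>Conjugation is injective and \<open>H\<close> is finite, so mapping \<open>H\<close>
  into itself already means mapping it onto itself.\<close>

lemma (in group) mem_normalizer_iff: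
  assumes fin: "finite (carrier G)" and H: "subgroup H G"
  shows "g \<in> normalizer G H \<longleftrightarrow> g \<in> carrier G \<and> (\<forall>h\<in>H. g \<otimes> h \<otimes> inv g \<in> H)"
proof -
  have HG: "H \<subseteq> carrier G" using H subgroup.subset by blast
  have eq: "g <# H #> inv g = (\<lambda>h. g \<otimes> h \<otimes> inv g) ` H" by (auto simp: l_coset_def r_coset_def)
  have "g <# H #> inv g = H \<longleftrightarrow> (\<forall>h\<in>H. g \<otimes> h \<otimes> inv g \<in> H)" if g: "g \<in> carrier G"
  proof
    assume "\<forall>h\<in>H. g \<otimes> h \<otimes> inv g \<in> H"
    moreover have "inj_on (\<lambda>h. g \<otimes> h \<otimes> inv g) H"
      using g HG conjugation_is_inj unfolding inj_on_def by blast
    ultimately show "g <# H #> inv g = H"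
      unfolding eq using fin HG by (meson endo_inj_surj finite_subset image_subsetI)
  qed (use eq in auto)
  then show ?thesis using HG by (auto simp: normalizer_def stabilizer_def)
qed

text \<open>Let \<open>P\<close> act on its own cosets: \<open>P #> g\<close> is fixed exactly when
  \<open>g\<close> normalizes \<open>P\<close>. So \<open>P\<close> itself is the only fixed point
  and the index is prime to p, which makes \<open>P\<close> a Sylow subgroup.\<close>

lemma (in group) self_normalizing_p_subgroup_index:
  fixes p :: nat
  assumes fin: "finite (carrier G)" and p: "prime p"
    and P: "subgroup P G" "card P = p ^ n" and N: "normalizer G P = P"
  shows "\<not> p ^ Suc n dvd order G"
proof -
  have "{R \<in> rcosets P. \<forall>q\<in>P. R #> q = R} = {P}"
  proof (intro equalityI subsetI)
    fix R assume "R \<in> {R \<in> rcosets P. \<forall>q\<in>P. R #> q = R}"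
    then obtain g where g: "g \<in> carrier G" "R = P #> g" "\<forall>q\<in>P. (P #> g) #> q = P #> g" by (auto simp: RCOSETS_def)
    then have "\<forall>q\<in>P. g \<otimes> q \<otimes> inv g \<in> P" using rcoset_fixed_iff[OF P(1)] subgroup.mem_carrier[OF P(1)] by blast
    then have "g \<in> P" using mem_normalizer_iff[OF fin P(1)] N g by blast
    then show "R \<in> {P}" using g coset_join2 P(1) by auto
  next
    fix R assume "R \<in> {P}"
    then show "R \<in> {R \<in> rcosets P. \<forall>q\<in>P. R #> q = R}"
      using P(1) subgroup.subgroup_in_rcosets[OF P(1) is_group] subgroup.rcos_const[OF P(1) is_group] by auto
  qed
  then have "\<not> p dvd card (rcosets P)"
    using prime_dvd_card_fixed_rcosets_iff[OF fin p P P(1)] p by (auto simp: prime_nat_iff)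
  then show ?thesis using lagrange[OF P(1)] P(2) p
    by (metis mult.commute nat_mult_dvd_cancel_disj power_Suc power_not_zero not_prime_0)
qed

lemma (in group) conj_mult:
  assumes "g \<in> carrier G" "x \<in> carrier G" "y \<in> carrier G"
  shows "g \<otimes> (x \<otimes> y) \<otimes> inv g = (g \<otimes> x \<otimes> inv g) \<otimes> (g \<otimes> y \<otimes> inv g)"
  using assms by (simp add: m_assoc inv_solve_left)

lemma (in group) conj_conj:
  assumes "g \<in> carrier G" "h \<in> carrier G" "x \<in> carrier G"
  shows "g \<otimes> (h \<otimes> x \<otimes> inv h) \<otimes> inv g = (g \<otimes> h) \<otimes> x \<otimes> inv (g \<otimes> h)"
  using assms by (simp add: m_assoc inv_mult_group)

lemma (in group) mem_conj_subgroup_iff: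
  assumes "x \<in> carrier G" "H \<subseteq> carrier G"
  shows "h \<in> conj_subgroup G H x \<longleftrightarrow> h \<in> carrier G \<and> x \<otimes> h \<otimes> inv x \<in> H"
proof
  assume "h \<in> conj_subgroup G H x"
  then obtain k where "k \<in> H" "h = inv x \<otimes> k \<otimes> x"
    by (auto simp: conj_subgroup_def l_coset_def r_coset_def)
  then show "h \<in> carrier G \<and> x \<otimes> h \<otimes> inv x \<in> H"
    using assms conjugation_is_surj[of x k] by auto
next
  assume *: "h \<in> carrier G \<and> x \<otimes> h \<otimes> inv x \<in> H"
  then have "inv x \<otimes> (x \<otimes> h \<otimes> inv x) \<otimes> x = h"
    using assms conj_conj[of "inv x" x h] by simp
  with * show "h \<in> conj_subgroup G H x"
    unfolding conj_subgroup_def l_coset_def r_coset_def by blast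
qed

lemma (in group) subgroup_conj_subgroup:
  assumes "x \<in> carrier G" "subgroup H G"
  shows "subgroup (conj_subgroup G H x) G"
  unfolding conj_subgroup_def using assms by (rule subgroup_conjugation_is_surj1)

lemma (in group) card_conj_subgroup:
  assumes "x \<in> carrier G" "H \<subseteq> carrier G"
  shows "card (conj_subgroup G H x) = card H"
proof -
  have "conj_subgroup G H x = (\<lambda>h. inv x \<otimes> h \<otimes> inv (inv x)) ` H"
    using assms by (auto simp: conj_subgroup_def l_coset_def r_coset_def)
  moreover have "inj_on (\<lambda>h. inv x \<otimes> h \<otimes> inv (inv x)) H"
    using assms conjugation_is_inj[of "inv x"] unfolding inj_on_def by blast
  ultimately show ?thesis by (simp only: card_image)
qed

lemma (in group) card_subgroup_dvd:
  assumes "subgroup H G" "subgroup K G" "H \<subseteq> K"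
  shows "card H dvd card K"
proof -
  interpret K: group "G\<lparr>carrier := K\<rparr>" using assms(2) by (rule subgroup_imp_group)
  have "subgroup H (G\<lparr>carrier := K\<rparr>)" using assms by (simp add: subgroup_incl)
  from K.lagrange[OF this] show ?thesis by (simp add: order_def) (metis dvd_triv_right)
qed

text \<open>A Frattini argument. \<open>H\<close> contains a conjugate \<open>?P1\<close> of the
  Sylow subgroup \<open>P\<close>. Both \<open>?P1\<close> and its conjugate \<open>?P2\<close> by
  \<open>y\<close> are Sylow in the join \<open>?J\<close>, so some \<open>j\<close> in
  \<open>?J\<close> carries \<open>?P2\<close> back to \<open>?P1\<close>. Then j y^-1 normalizes
  \<open>?P1\<close>, hence lies in it and in \<open>?J\<close>, and so does
  \<open>y\<close>.\<close>

lemma (in group) abnormal_if_contains_self_normalizing_p_subgroup: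
  fixes p :: nat
  assumes fin: "finite (carrier G)" and p: "prime p"
    and P: "subgroup P G" "card P = p ^ n" and N: "normalizer G P = P"
    and H: "subgroup H G" and n: "p ^ n dvd card H"
  shows "abnormal H G"
  unfolding abnormal_def
proof (intro conjI ballI H)
  fix y assume y: "y \<in> carrier G"
  have HG: "H \<subseteq> carrier G" using H subgroup.subset by blast
  have PG: "P \<subseteq> carrier G" using P(1) subgroup.subset by blast
  have nd: "\<not> p ^ Suc n dvd order G" by (rule self_normalizing_p_subgroup_index[OF fin p P N])
  obtain g where g: "g \<in> carrier G" "\<And>q. q \<in> P \<Longrightarrow> g \<otimes> q \<otimes> inv g \<in> H"
    using p_subgroup_conjugate_into[OF fin p P H n nd] by blast
  \<comment> \<open>\<open>conj_subgroup G H x\<close> is x^-1 H x, so the argument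
    \<open>inv g\<close> produces g P g^-1.\<close>
  let ?P1 = "conj_subgroup G P (inv g)"
  have ig: "inv g \<in> carrier G" using g by simp
  have P1: "subgroup ?P1 G" "card ?P1 = p ^ n"
    using subgroup_conj_subgroup[OF ig P(1)] card_conj_subgroup[OF ig PG] P(2) by auto
  have P1G: "?P1 \<subseteq> carrier G" using P1(1) subgroup.subset by blast
  have P1H: "?P1 \<subseteq> H"
  proof
    fix h assume h: "h \<in> ?P1"
    then have *: "h \<in> carrier G" "inv g \<otimes> h \<otimes> inv (inv g) \<in> P"
      using mem_conj_subgroup_iff[OF ig PG] by blast+
    have "g \<otimes> (inv g \<otimes> h \<otimes> inv (inv g)) \<otimes> inv g = h"
      using *(1) g(1) conj_conj[of g "inv g" h] by simp
    with g(2)[OF *(2)] show "h \<in> H" by simp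
  qed
  let ?J = "generate G (H \<union> conj_subgroup G H y)"
  have cyH: "conj_subgroup G H y \<subseteq> carrier G"
    using mem_conj_subgroup_iff[OF y HG] by blast
  then have J: "subgroup ?J G" using HG by (intro generate_is_subgroup) auto
  have JH: "H \<subseteq> ?J" "conj_subgroup G H y \<subseteq> ?J" using generate.incl[of _ _ G] by blast+
  have JG: "?J \<subseteq> carrier G" using J subgroup.subset by blast
  interpret J: group "G\<lparr>carrier := ?J\<rparr>" using J by (rule subgroup_imp_group)
  let ?P2 = "conj_subgroup G ?P1 y"
  have P2J: "?P2 \<subseteq> ?J"
    using P1H JH(2) mem_conj_subgroup_iff[OF y HG] mem_conj_subgroup_iff[OF y P1G] by blast
  have P2: "subgroup ?P2 (G\<lparr>carrier := ?J\<rparr>)" "card ?P2 = p ^ n"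
    using subgroup_incl[OF subgroup_conj_subgroup[OF y P1(1)] J P2J] card_conj_subgroup[OF y P1G] P1 by auto
  have P1J: "subgroup ?P1 (G\<lparr>carrier := ?J\<rparr>)"
    using subgroup_incl[OF P1(1) J] P1H JH(1) by blast
  have "\<not> p ^ Suc n dvd order (G\<lparr>carrier := ?J\<rparr>)"
  proof
    assume "p ^ Suc n dvd order (G\<lparr>carrier := ?J\<rparr>)"
    also have "\<dots> = card ?J" by (simp add: order_def)
    also have "card ?J dvd order G" using lagrange[OF J] by (metis dvd_triv_right)
    finally show False using nd by blast
  qed
  then obtain j where j: "j \<in> ?J"
      "\<And>q. q \<in> ?P2 \<Longrightarrow> j \<otimes> q \<otimes> inv\<^bsub>G\<lparr>carrier := ?J\<rparr>\<^esub> j \<in> ?P1"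
    using J.p_subgroup_conjugate_into[OF _ p P2 P1J, of n] P1(2) finite_subset[OF JG fin] by auto
  have jG: "j \<in> carrier G" using j JG by blast
  \<comment> \<open>The element j y^-1 normalizes \<open>?P1\<close>. Conjugated back by
    \<open>g\<close> it normalizes \<open>P\<close>, where self-normalization is assumed.\<close>
  let ?z = "inv g \<otimes> (j \<otimes> inv y) \<otimes> g"
  have zG: "?z \<in> carrier G" using g y jG by simp
  have "?z \<otimes> h \<otimes> inv ?z \<in> P" if h: "h \<in> P" for h
  proof -
    have hG: "h \<in> carrier G" using h PG by blast
    let ?q = "inv y \<otimes> (g \<otimes> h \<otimes> inv g) \<otimes> inv (inv y)"
    have "inv g \<otimes> (g \<otimes> h \<otimes> inv g) \<otimes> inv (inv g) = h"
      using hG g(1) conj_conj[of "inv g" g h] by simp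
    then have "g \<otimes> h \<otimes> inv g \<in> ?P1" using mem_conj_subgroup_iff[OF ig PG] h hG g(1) by simp
    moreover have "y \<otimes> ?q \<otimes> inv y = g \<otimes> h \<otimes> inv g"
      using hG g(1) y conj_conj[of y "inv y" "g \<otimes> h \<otimes> inv g"] by simp
    ultimately have "?q \<in> ?P2" using mem_conj_subgroup_iff[OF y P1G] hG g(1) y by simp
    then have "j \<otimes> ?q \<otimes> inv j \<in> ?P1" using j(2)[of ?q] m_inv_consistent[OF J j(1)] by simp
    then have "inv g \<otimes> (j \<otimes> ?q \<otimes> inv j) \<otimes> inv (inv g) \<in> P" using mem_conj_subgroup_iff[OF ig PG] by blast
    moreover have "inv g \<otimes> (j \<otimes> ?q \<otimes> inv j) \<otimes> inv (inv g) = ?z \<otimes> h \<otimes> inv ?z"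
      using hG g(1) y jG by (simp add: m_assoc inv_mult_group)
    ultimately show ?thesis by simp
  qed
  then have "?z \<in> P" using mem_normalizer_iff[OF fin P(1)] zG N by blast
  moreover have "inv g \<otimes> (j \<otimes> inv y) \<otimes> inv (inv g) = ?z" using g by simp
  ultimately have "j \<otimes> inv y \<in> ?P1" using mem_conj_subgroup_iff[OF ig PG] jG y by simp
  then have "j \<otimes> inv y \<in> ?J" using P1H JH by blast
  then have "inv (j \<otimes> inv y) \<otimes> j \<in> ?J" using j(1) J by (meson subgroup.m_closed subgroup.m_inv_closed)
  moreover have "inv (j \<otimes> inv y) \<otimes> j = y" using jG y by (simp add: inv_mult_group m_assoc)
  ultimately show "y \<in> ?J" by simp
qed

text \<open>If \<open>g\<close> normalizes \<open>H\<close>, then the join of \<open>H\<close> and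
  its conjugate by \<open>g\<close> is \<open>H\<close>, and abnormality puts \<open>g\<close> into
  it.\<close>

lemma (in group) abnormal_imp_self_normalizing:
  assumes fin: "finite (carrier G)" and H: "abnormal H G"
  shows "self_normalizing H G"
proof -
  have sub: "subgroup H G" using H by (simp add: abnormal_def)
  have HG: "H \<subseteq> carrier G" using sub subgroup.subset by blast
  have "g \<in> H" if g: "g \<in> normalizer G H" for g
  proof -
    have gG: "g \<in> carrier G" and "inv g \<in> normalizer G H"
      using g mem_normalizer_iff[OF fin sub] subgroup.m_inv_closed[OF normalizer_imp_subgroup[OF HG]] by blast+
    then have *: "inv g \<otimes> h \<otimes> inv (inv g) \<in> H" if "h \<in> H" for h
      using mem_normalizer_iff[OF fin sub] that by blast
    have "conj_subgroup G H g \<subseteq> H"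
      using * gG by (auto simp: conj_subgroup_def l_coset_def r_coset_def)
    then have "generate G (H \<union> conj_subgroup G H g) \<subseteq> H" using sub by (intro generate_subgroup_incl) auto
    then show ?thesis using H gG by (auto simp: abnormal_def)
  qed
  moreover have "H \<subseteq> normalizer G H"
    using mem_normalizer_iff[OF fin sub] sub HG by (meson subgroup.m_closed subgroup.m_inv_closed subsetD subsetI)
  ultimately show ?thesis using sub by (auto simp: self_normalizing_def)
qed

lemma (in group) normal_self_normalizing_eq_carrier:
  assumes fin: "finite (carrier G)" and "H \<lhd> G" and "self_normalizing H G"
  shows "H = carrier G"
  using assms mem_normalizer_iff[OF fin, of H] normal_inv_iff[of H] subgroup.subset[of H G]
  unfolding self_normalizing_def by blast

section \<open>Orders of elements and of p-subgroups\<close>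

lemma (in group) pow_card_subgroup:
  assumes "subgroup H G" "x \<in> H"
  shows "x [^] card H = \<one>"
  using group.pow_order_eq_1[OF subgroup_imp_group[OF assms(1)], of x] assms
  by (simp add: order_def nat_pow_consistent[symmetric])

lemma (in group) ord_dvd_card_subgroup:
  assumes "subgroup H G" "x \<in> H"
  shows "ord x dvd card H"
  using pow_card_subgroup[OF assms] pow_eq_id[of x] subgroup.mem_carrier[OF assms] by blast

lemma (in group) coprime_subgroups_Int:
  assumes "subgroup H G" "subgroup K G" "coprime (card H) (card K)"
  shows "H \<inter> K = {\<one>}"
proof -
  have "x = \<one>" if "x \<in> H" "x \<in> K" for x
  proof -
    have "ord x dvd card H" "ord x dvd card K" using assms that ord_dvd_card_subgroup by blast+
    then have "ord x = 1" using assms(3) by (metis coprime_common_divisor_nat)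
    then show ?thesis using ord_eq_1 subgroup.mem_carrier[OF assms(1) that(1)] by blast
  qed
  then show ?thesis using assms by (auto simp: subgroup.one_closed)
qed

lemma (in group) cauchy:
  fixes p :: nat
  assumes fin: "finite (carrier G)" and p: "prime p" and H: "subgroup H G" and d: "p dvd card H"
  obtains x where "x \<in> H" "ord x = p"
proof -
  interpret H: group "G\<lparr>carrier := H\<rparr>" using H by (rule subgroup_imp_group)
  have HG: "H \<subseteq> carrier G" using H subgroup.subset by blast
  obtain m where "card H = p ^ 1 * m" using d by (auto elim: dvdE)
  then obtain K where K: "subgroup K (G\<lparr>carrier := H\<rparr>)" "card K = p ^ 1"
    using sylow_thm[OF p H.is_group, of 1 m] finite_subset[OF HG fin] by (auto simp: order_def)
  have KG: "subgroup K G" "K \<subseteq> H" using incl_subgroup[OF H K(1)] subgroup.subset[OF K(1)] by auto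
  have "card K > 1" using K(2) p prime_gt_1_nat by simp
  then have "K \<noteq> {\<one>}" by auto
  then obtain x where x: "x \<in> K" "x \<noteq> \<one>" using KG(1) subgroup.one_closed by blast
  then have "ord x dvd p" "ord x \<noteq> 1"
    using ord_dvd_card_subgroup[OF KG(1), of x] K(2) ord_eq_1 subgroup.mem_carrier[OF KG(1)] by auto
  then have "ord x = p" using p by (auto simp: prime_nat_iff)
  then show ?thesis using that x KG(2) by blast
qed

text \<open>By Cauchy, a prime other than p dividing the order would itself be the order of an
  element.\<close>

lemma (in group) card_p_subgroup:
  fixes p :: nat
  assumes fin: "finite (carrier G)" and p: "prime p" and H: "subgroup H G"
    and pow: "\<And>x. x \<in> H \<Longrightarrow> \<exists>k. ord x = p ^ k"
  obtains k where "card H = p ^ k"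
proof -
  have HG: "H \<subseteq> carrier G" using H subgroup.subset by blast
  have "card H \<noteq> 0" using H fin HG by (metis card_0_eq empty_iff finite_subset subgroup.one_closed)
  then obtain k m where km: "card H = p ^ k * m" "\<not> p dvd m"
    using p multiplicity_decompose'[of "card H" p] by (metis multiplicity_decompose' not_prime_unit)
  have "m = 1"
  proof (rule ccontr)
    assume "m \<noteq> 1"
    then obtain q where q: "prime q" "q dvd m" using prime_factor_nat by blast
    then have "q dvd card H" using km by simp
    then obtain x where x: "x \<in> H" "ord x = q" using cauchy[OF fin q(1) H] by blast
    then obtain j where "q = p ^ j" using pow by metis
    then have "q = p" using p q(1) by (metis prime_dvd_power primes_dvd_imp_eq dvd_refl)
    then show False using q km by simp
  qed
  then show ?thesis using that km by simp
qed

subsection \<open>Normal complements of self-normalizing Sylow subgroups\<close>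

lemma (in group) conj_nat_pow:
  assumes "g \<in> carrier G" "x \<in> carrier G"
  shows "(g \<otimes> x \<otimes> inv g) [^] (k::nat) = g \<otimes> x [^] k \<otimes> inv g"
proof (induction k)
  case (Suc k)
  then show ?case using assms conj_mult[of g "x [^] k" x] by simp
qed (use assms in simp)

lemma (in group) ord_conj:
  assumes "g \<in> carrier G" "x \<in> carrier G"
  shows "ord (g \<otimes> x \<otimes> inv g) = ord x"
proof -
  have "g \<otimes> x [^] k \<otimes> inv g = \<one> \<longleftrightarrow> x [^] k = \<one>" for k :: nat
    using conjugation_is_inj[OF assms(1), of "x [^] k" \<one>] assms by auto
  then show ?thesis using assms by (simp add: ord_unique conj_nat_pow pow_eq_id[symmetric])
qed

text \<open>\<open>c\<close> is the commutator [a,b]. Since \<open>a\<close> commutes with it,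
  [a^k,b] = c^k for all k, and k = \<open>ord a\<close> gives c^k = 1. So the order of
  \<open>c\<close> divides that of \<open>a\<close>, and coprimality forces c = 1.\<close>

lemma (in group) commute_if_coprime_commutator:
  assumes ab: "a \<in> carrier G" "b \<in> carrier G" and c: "c \<in> carrier G"
    and comm: "a \<otimes> b = c \<otimes> (b \<otimes> a)" and ac: "a \<otimes> c = c \<otimes> a"
    and cop: "coprime (ord a) (ord c)"
  shows "a \<otimes> b = b \<otimes> a"
proof -
  have ack: "a \<otimes> c [^] k = c [^] k \<otimes> a" for k :: nat
  proof (induction k)
    case (Suc k)
    have "a \<otimes> c [^] Suc k = (a \<otimes> c [^] k) \<otimes> c" using ab c by (simp add: m_assoc)
    also have "\<dots> = c [^] k \<otimes> (a \<otimes> c)" using Suc ab c by (simp add: m_assoc)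
    also have "\<dots> = c [^] Suc k \<otimes> a" using ac ab c by (simp add: m_assoc)
    finally show ?case .
  qed (use ab in simp)
  have pw: "a [^] k \<otimes> b = c [^] k \<otimes> (b \<otimes> a [^] k)" for k :: nat
  proof (induction k)
    case (Suc k)
    have "a [^] Suc k \<otimes> b = a \<otimes> (a [^] k \<otimes> b)" using ab by (simp only: nat_pow_Suc2) (simp add: m_assoc)
    also have "\<dots> = (a \<otimes> c [^] k) \<otimes> (b \<otimes> a [^] k)" using Suc ab c by (simp add: m_assoc)
    also have "\<dots> = c [^] k \<otimes> ((a \<otimes> b) \<otimes> a [^] k)" using ack ab c by (simp add: m_assoc)
    also have "\<dots> = c [^] Suc k \<otimes> (b \<otimes> (a \<otimes> a [^] k))" using comm ab c by (simp add: m_assoc)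
    also have "a \<otimes> a [^] k = a [^] Suc k" using ab by (simp only: nat_pow_Suc2)
    finally show ?case .
  qed (use ab in simp)
  have "b = c [^] ord a \<otimes> b" using pw[of "ord a"] ab by simp
  then have "c [^] ord a = \<one>" using ab c by (metis nat_pow_closed r_cancel_one')
  then have "ord c dvd ord a" using c pow_eq_id by blast
  then have "ord c = 1" using cop by (metis coprime_common_divisor_nat dvd_refl)
  then have "c = \<one>" using c ord_eq_1 by blast
  then show ?thesis using comm ab by simp
qed

text \<open>
  The argument is the one showing \<open>C(O\<^sub>p(G)) \<le> O\<^sub>p(G)\<close> when \<open>G\<close> has no nontrivial normal subgroup of
  order prime to \<open>p\<close>: the \<open>p\<close>-regular elements of a class 2 normal subgroup of the centralizer form
  such a subgroup.
\<close>

lemma (in group) abelian_sylow_normal: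
  fixes p :: nat
  assumes fin: "finite (carrier G)" and sol: "solvable G" and p: "prime p"
    and P: "subgroup P G" "card P = p ^ n" and nd: "\<not> p ^ Suc n dvd order G"
    and ab: "\<And>a b. a \<in> P \<Longrightarrow> b \<in> P \<Longrightarrow> a \<otimes> b = b \<otimes> a"
    and no: "\<And>T. T \<lhd> G \<Longrightarrow> \<not> p dvd card T \<Longrightarrow> T = {\<one>}"
  shows "P \<lhd> G"
proof -
  have PG: "P \<subseteq> carrier G" using P(1) subgroup.subset by blast
  \<comment> \<open>The normal core of \<open>P\<close>. By \<open>max\<close> below it contains
    every normal p-subgroup, so it is the largest one.\<close>
  define N where "N = {g \<in> carrier G. \<forall>x\<in>carrier G. x \<otimes> g \<otimes> inv x \<in> P}"
  have NP: "N \<subseteq> P"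
  proof
    fix g assume g: "g \<in> N"
    then have "\<one> \<otimes> g \<otimes> inv \<one> \<in> P" "g \<in> carrier G" unfolding N_def by blast+
    then show "g \<in> P" by simp
  qed
  have N: "N \<lhd> G"
  proof (rule normal_invI)
    show "subgroup N G"
    proof (rule subgroupI)
      show "N \<subseteq> carrier G" by (auto simp: N_def)
      have "\<one> \<in> N" using P(1) by (simp add: N_def subgroup.one_closed)
      then show "N \<noteq> {}" by blast
      show "inv a \<in> N" if a: "a \<in> N" for a
      proof -
        have "x \<otimes> inv a \<otimes> inv x = inv (x \<otimes> a \<otimes> inv x)" if "x \<in> carrier G" for x
          using that a by (simp add: N_def inv_mult_group m_assoc)
        then show ?thesis using a subgroup.m_inv_closed[OF P(1)] by (simp add: N_def)
      qed
      show "a \<otimes> b \<in> N" if "a \<in> N" "b \<in> N" for a b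
        using that conj_mult[of _ a b] subgroup.m_closed[OF P(1)] by (simp add: N_def)
    qed
    show "x \<otimes> h \<otimes> inv x \<in> N" if "x \<in> carrier G" "h \<in> N" for x h
      using that conj_conj[of _ x h] by (simp add: N_def)
  qed
  have max: "A \<subseteq> N" if A: "A \<lhd> G" "card A = p ^ k" for A k
  proof
    fix a assume a: "a \<in> A"
    have Asub: "subgroup A G" and Aconj: "\<And>x h. x \<in> carrier G \<Longrightarrow> h \<in> A \<Longrightarrow> x \<otimes> h \<otimes> inv x \<in> A"
      using A(1) normal_inv_iff by blast+
    have AG: "A \<subseteq> carrier G" using Asub subgroup.subset by blast
    obtain g where g: "g \<in> carrier G" "\<And>q. q \<in> A \<Longrightarrow> g \<otimes> q \<otimes> inv g \<in> P"
      using p_subgroup_conjugate_into[OF fin p Asub A(2) P(1) _ nd] P(2) by auto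
    have "x \<otimes> a \<otimes> inv x \<in> P" if x: "x \<in> carrier G" for x
    proof -
      have "inv g \<otimes> (x \<otimes> a \<otimes> inv x) \<otimes> inv (inv g) \<in> A"
        by (rule Aconj[OF inv_closed[OF g(1)] Aconj[OF x a]])
      moreover have "g \<otimes> (inv g \<otimes> (x \<otimes> a \<otimes> inv x) \<otimes> inv (inv g)) \<otimes> inv g = x \<otimes> a \<otimes> inv x"
        using conj_conj[of g "inv g" "x \<otimes> a \<otimes> inv x"] g(1) x a AG by auto
      ultimately show ?thesis using g(2) by metis
    qed
    then show "a \<in> N" using a AG by (auto simp: N_def)
  qed
  \<comment> \<open>The centralizer of \<open>N\<close>, which contains the abelian group
    \<open>P\<close>. Once \<open>C\<close> is inside \<open>N\<close>, the inclusions P <= C <= N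
    <= P close up.\<close>
  define C where "C = {g \<in> carrier G. \<forall>x\<in>N. g \<otimes> x = x \<otimes> g}"
  have NG: "N \<subseteq> carrier G" using NP PG by blast
  have PC: "P \<subseteq> C" using ab PG NP by (auto simp: C_def)
  have Csub: "subgroup C G"
  proof (rule subgroupI)
    show "C \<subseteq> carrier G" by (auto simp: C_def)
    show "C \<noteq> {}" using PC subgroup.one_closed[OF P(1)] by blast
    show "inv a \<in> C" if a: "a \<in> C" for a
    proof -
      have "inv a \<otimes> x = x \<otimes> inv a" if x: "x \<in> N" for x
      proof -
        have aG: "a \<in> carrier G" and xG: "x \<in> carrier G" and "a \<otimes> x = x \<otimes> a" using a x NG by (auto simp: C_def)
        then have "a \<otimes> x \<otimes> inv a = x" by (simp add: m_assoc)
        then show ?thesis using aG xG by (metis inv_closed inv_solve_left m_assoc m_closed)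
      qed
      then show ?thesis using a by (simp add: C_def)
    qed
    show "a \<otimes> b \<in> C" if "a \<in> C" "b \<in> C" for a b
    proof -
      have "a \<otimes> b \<otimes> x = x \<otimes> (a \<otimes> b)" if x: "x \<in> N" for x
      proof -
        have G: "a \<in> carrier G" "b \<in> carrier G" "x \<in> carrier G" and c: "a \<otimes> x = x \<otimes> a" "b \<otimes> x = x \<otimes> b"
          using \<open>a \<in> C\<close> \<open>b \<in> C\<close> x NG by (auto simp: C_def)
        have "a \<otimes> b \<otimes> x = (a \<otimes> x) \<otimes> b" using G c(2) by (simp add: m_assoc)
        also have "\<dots> = x \<otimes> (a \<otimes> b)" unfolding c(1) using G by (simp add: m_assoc)
        finally show ?thesis .
      qed
      then show ?thesis using that by (simp add: C_def)
    qed
  qed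
  have C: "C \<lhd> G"
  proof (rule normal_invI[OF Csub])
    fix x h assume x: "x \<in> carrier G" and h: "h \<in> C"
    have hG: "h \<in> carrier G" using h by (simp add: C_def)
    have "(x \<otimes> h \<otimes> inv x) \<otimes> y = y \<otimes> (x \<otimes> h \<otimes> inv x)" if y: "y \<in> N" for y
    proof -
      have yG: "y \<in> carrier G" using y NG by blast
      have "inv x \<otimes> y \<otimes> inv (inv x) \<in> N" using N normal_inv_iff x y by (metis inv_closed)
      then have c: "h \<otimes> (inv x \<otimes> y \<otimes> x) = (inv x \<otimes> y \<otimes> x) \<otimes> h" using h x by (simp add: C_def)
      have "(x \<otimes> h \<otimes> inv x) \<otimes> y = x \<otimes> (h \<otimes> (inv x \<otimes> y \<otimes> x)) \<otimes> inv x"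
        using x hG yG by (simp add: m_assoc)
      also have "\<dots> = x \<otimes> ((inv x \<otimes> y \<otimes> x) \<otimes> h) \<otimes> inv x" by (simp only: c)
      also have "\<dots> = (x \<otimes> inv x) \<otimes> y \<otimes> (x \<otimes> h \<otimes> inv x)" using x hG yG by (simp only: m_assoc inv_closed m_closed)
      finally show ?thesis using x hG yG by simp
    qed
    then show "x \<otimes> h \<otimes> inv x \<in> C" using x hG by (simp add: C_def)
  qed
  have "C \<subseteq> N"
  proof (rule ccontr)
    assume "\<not> C \<subseteq> N"
    \<comment> \<open>Solubility enters here: the derived series of \<open>C\<close> reaches 1. Its
      last term \<open>A\<close> not inside \<open>N\<close> has its derived subgroup inside
      \<open>N\<close>, and as a subgroup of \<open>C\<close> it centralizes \<open>N\<close>, so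
      \<open>A\<close> has class at most 2.\<close>
    define D where "D i = (derived G ^^ i) C" for i
    obtain m where "D m = {\<one>}"
      using solvable_imp_trivial_derived_seq[OF solvable_subgroup[OF Csub sol]] by (auto simp: D_def)
    then have Dm: "D m \<subseteq> N" using N subgroup.one_closed[OF normal_imp_subgroup] by auto
    define i where "i = (LEAST i. D i \<subseteq> N)"
    have Di: "D i \<subseteq> N" unfolding i_def using Dm by (rule LeastI)
    have "i \<noteq> 0" using Di \<open>\<not> C \<subseteq> N\<close> by (auto simp: D_def)
    then obtain j where j: "i = Suc j" using not0_implies_Suc by blast
    define A where "A = D j"
    have AN: "\<not> A \<subseteq> N" using not_less_Least[of j "\<lambda>i. D i \<subseteq> N"] j by (auto simp: A_def i_def)
    have dA: "derived G A \<subseteq> N" using Di j by (simp add: A_def D_def)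
    have "D k \<lhd> G \<and> D k \<subseteq> C" for k
    proof (induction k)
      case (Suc k)
      then show ?case using derived_is_normal derived_incl[OF _ Csub] by (simp add: D_def)
    qed (simp add: D_def C)
    then have A: "A \<lhd> G" "A \<subseteq> C" by (auto simp: A_def)
    have Asub: "subgroup A G" and Aconj: "\<And>x h. x \<in> carrier G \<Longrightarrow> h \<in> A \<Longrightarrow> x \<otimes> h \<otimes> inv x \<in> A"
      using A(1) normal_inv_iff by blast+
    have AG: "A \<subseteq> carrier G" using Asub subgroup.subset by blast
    define T where "T = {a \<in> A. coprime (ord a) p}"
    have TA: "T \<subseteq> A" by (auto simp: T_def)
    \<comment> \<open>The commutator of \<open>a\<close> and \<open>b\<close> lies in
      \<open>N\<close>, so its order is a power of p and it commutes with \<open>a\<close>, whose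
      order is prime to p. Commutativity is what makes \<open>T\<close> closed under
      products.\<close>
    have comm: "a \<otimes> b = b \<otimes> a" if a: "a \<in> T" and b: "b \<in> T" for a b
    proof -
      have aA: "a \<in> A" "b \<in> A" and aG: "a \<in> carrier G" "b \<in> carrier G" using a b TA AG by blast+
      let ?c = "a \<otimes> b \<otimes> inv a \<otimes> inv b"
      have "?c \<in> derived_set G A" using aA by blast
      then have "?c \<in> derived G A" unfolding derived_def by (rule generate.incl)
      then have cN: "?c \<in> N" using dA by blast
      then have cP: "?c \<in> P" using NP by blast
      have cG: "?c \<in> carrier G" using aG by simp
      have "ord ?c dvd p ^ n" using ord_dvd_card_subgroup[OF P(1) cP] P(2) by simp
      moreover have "coprime (ord a) (p ^ n)" using a by (simp add: T_def)
      ultimately have cop: "coprime (ord a) (ord ?c)" by (metis coprime_divisors dvd_refl)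
      have "a \<in> C" using aA A(2) by blast
      then have ac: "a \<otimes> ?c = ?c \<otimes> a" using cN by (simp add: C_def)
      have "inv b \<otimes> (b \<otimes> a) = a" using aG by (simp flip: m_assoc)
      then have "a \<otimes> b = ?c \<otimes> (b \<otimes> a)" using aG by (simp add: m_assoc)
      then show ?thesis by (rule commute_if_coprime_commutator[OF aG cG _ ac cop])
    qed
    have T: "T \<lhd> G"
    proof (rule normal_invI)
      show "subgroup T G"
      proof (rule subgroupI)
        show "T \<subseteq> carrier G" using TA AG by blast
        have "\<one> \<in> T" using subgroup.one_closed[OF Asub] by (simp add: T_def)
        then show "T \<noteq> {}" by blast
        show "inv a \<in> T" if "a \<in> T" for a
          using that AG subgroup.m_inv_closed[OF Asub] by (auto simp: T_def)
        show "a \<otimes> b \<in> T" if ab': "a \<in> T" "b \<in> T" for a b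
        proof -
          have "a \<in> carrier G" "b \<in> carrier G" using ab' TA AG by blast+
          then have "ord (a \<otimes> b) dvd ord a * ord b" by (rule ord_mul_divides[OF comm[OF ab']])
          moreover have "coprime (ord a * ord b) p" using ab' by (simp add: T_def)
          ultimately have "coprime (ord (a \<otimes> b)) p" by (metis coprime_divisors dvd_refl)
          then show ?thesis using ab' subgroup.m_closed[OF Asub] by (simp add: T_def)
        qed
      qed
      show "x \<otimes> h \<otimes> inv x \<in> T" if "x \<in> carrier G" "h \<in> T" for x h
        using that Aconj ord_conj AG by (auto simp: T_def)
    qed
    have "\<not> p dvd card T"
    proof
      assume "p dvd card T"
      then obtain x where "x \<in> T" "ord x = p" using cauchy[OF fin p normal_imp_subgroup[OF T]] by blast
      then have "coprime p p" by (simp add: T_def)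
      then show False using p by simp
    qed
    then have T1: "T = {\<one>}" using no T by blast
    \<comment> \<open>With k the exponent of p in the order of \<open>a\<close>, the power of
      \<open>a\<close> by p^k lands in the trivial group \<open>T\<close>. So \<open>A\<close> is a
      normal p-subgroup, contradicting the choice of \<open>A\<close> outside
      \<open>N\<close>.\<close>
    have "\<exists>k. ord a = p ^ k" if a: "a \<in> A" for a
    proof -
      have aG: "a \<in> carrier G" using a AG by blast
      have "ord a \<noteq> 0" using ord_ge_1[OF fin aG] by simp
      then obtain k m where km: "ord a = p ^ k * m" "\<not> p dvd m"
        using p by (metis multiplicity_decompose' not_prime_unit)
      have "ord (a [^] (p ^ k)) = m" using ord_pow[OF aG, of "p ^ k"] km p by (auto simp: prime_gt_0_nat)
      moreover have "coprime m p" using prime_imp_coprime[OF p km(2)] by (simp add: coprime_commute)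
      moreover have "a [^] (p ^ k) \<in> A" using a Asub
        using subgroup_int_pow_closed[of A a "int (p ^ k)"] by (simp only: int_pow_int)
      ultimately have "a [^] (p ^ k) \<in> T" by (simp add: T_def)
      then have "a [^] (p ^ k) = \<one>" using T1 by simp
      then have "m = 1" using \<open>ord (a [^] (p ^ k)) = m\<close> by simp
      then show ?thesis using km by auto
    qed
    then obtain k where "card A = p ^ k" using card_p_subgroup[OF fin p Asub] by blast
    then show False using max A(1) AN by blast
  qed
  then have "P = N" using PC NP by blast
  then show ?thesis using N by simp
qed

lemma (in group) subset_set_mult_left:
  assumes "A \<subseteq> carrier G" "\<one> \<in> B"
  shows "A \<subseteq> A <#> B"
proof
  fix a assume a: "a \<in> A"
  then have "a \<otimes> \<one> \<in> A <#> B" using assms(2) unfolding set_mult_def by blast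
  then show "a \<in> A <#> B" using a assms(1) by auto
qed

lemma (in group) subset_set_mult_right:
  assumes "B \<subseteq> carrier G" "\<one> \<in> A"
  shows "B \<subseteq> A <#> B"
proof
  fix b assume b: "b \<in> B"
  then have "\<one> \<otimes> b \<in> A <#> B" using assms(2) unfolding set_mult_def by blast
  then show "b \<in> A <#> B" using b assms(1) by auto
qed

text \<open>\<open>K\<close> is a largest normal subgroup of order prime to p. Then G/K has no
  nontrivial normal subgroup of such order, so the image of the abelian Sylow subgroup
  \<open>P\<close> is normal there. Its preimage \<open>K <#> P\<close> is therefore normal in
  \<open>G\<close>, and it is self-normalizing because it contains \<open>P\<close>.\<close>

lemma (in group) normal_coprime_supplement:
  fixes p :: nat
  assumes fin: "finite (carrier G)" and sol: "solvable G" and p: "prime p"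
    and P: "subgroup P G" "card P = p ^ n" and N: "normalizer G P = P"
    and ab: "\<And>a b. a \<in> P \<Longrightarrow> b \<in> P \<Longrightarrow> a \<otimes> b = b \<otimes> a"
  obtains K where "K \<lhd> G" "\<not> p dvd card K" "K <#> P = carrier G"
proof -
  have PG: "P \<subseteq> carrier G" using P(1) subgroup.subset by blast
  have nd: "\<not> p ^ Suc n dvd order G" by (rule self_normalizing_p_subgroup_index[OF fin p P N])
  let ?X = "{K. K \<lhd> G \<and> \<not> p dvd card K}"
  have X1: "{\<one>} \<in> ?X" using one_is_normal p by (auto simp: prime_nat_iff)
  have bound: "card K \<le> card (carrier G)" if "K \<in> ?X" for K
    using that fin by (auto intro!: card_mono dest: normal_imp_subgroup subgroup.subset)
  obtain K where K: "K \<lhd> G" "\<not> p dvd card K"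
    and max: "\<And>L. L \<lhd> G \<Longrightarrow> \<not> p dvd card L \<Longrightarrow> card L \<le> card K"
    using ex_has_greatest_nat[of "\<lambda>K. K \<in> ?X" "{\<one>}" card "Suc (card (carrier G))"] X1 bound
    by (auto simp: less_Suc_eq_le)
  interpret K: normal K G by (rule K)
  have KG: "K \<subseteq> carrier G" and Ksub: "subgroup K G" using K.subset K.subgroup_axioms by auto
  have Kpos: "card K > 0" using K(2) by (metis dvd_0_right gr0I)
  interpret Q: group "G Mod K" by (rule K.factorgroup_is_group)
  let ?h = "\<lambda>a. K #> a"
  interpret h: group_hom G "G Mod K" ?h
    by unfold_locales (rule K.r_coset_hom_Mod)
  have surj: "?h ` carrier G = carrier (G Mod K)" by (simp add: carrier_FactGroup)
  have finQ: "finite (carrier (G Mod K))" using fin surj by (metis finite_imageI)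
  have solQ: "solvable (G Mod K)" using h.surj_hom_imp_solvable surj sol by blast
  have ordQ: "order (G Mod K) * card K = order G"
    using lagrange[OF Ksub] by (simp add: order_def FactGroup_def)
  have PQ: "subgroup (?h ` P) (G Mod K)" by (rule h.subgroup_img_is_subgroup[OF P(1)])
  have "coprime (card K) (card P)"
    using K(2) p P(2) by (simp add: coprime_commute prime_imp_coprime)
  then have KP: "K \<inter> P = {\<one>}" by (rule coprime_subgroups_Int[OF Ksub P(1)])
  \<comment> \<open>The image of \<open>P\<close> keeps the order p^n and is thus a Sylow subgroup
    of the quotient.\<close>
  have "inj_on ?h P"
  proof (rule inj_onI)
    fix a b assume a: "a \<in> P" and b: "b \<in> P" and e: "K #> a = K #> b"
    have aG: "a \<in> carrier G" "b \<in> carrier G" using a b PG by blast+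
    then have "a \<in> K #> b" using e rcos_self[OF aG(1) Ksub] by simp
    then have "a \<otimes> inv b \<in> K" using K.rcos_module_imp[OF is_group aG(2)] by blast
    moreover have "a \<otimes> inv b \<in> P" using a b P(1) by (simp add: subgroup.m_closed subgroup.m_inv_closed)
    ultimately have "a \<otimes> inv b = \<one>" using KP by blast
    then show "a = b" using aG by (metis inv_closed inv_equality inv_inv)
  qed
  then have cardPQ: "card (?h ` P) = p ^ n" using P(2) by (simp add: card_image)
  have ndQ: "\<not> p ^ Suc n dvd order (G Mod K)" using nd ordQ by (metis dvd_mult2)
  have abQ: "x \<otimes>\<^bsub>G Mod K\<^esub> y = y \<otimes>\<^bsub>G Mod K\<^esub> x" if xy: "x \<in> ?h ` P" "y \<in> ?h ` P" for x y
  proof -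
    obtain a b where ab': "a \<in> P" "b \<in> P" "x = ?h a" "y = ?h b" using xy by blast
    then have "?h (a \<otimes> b) = ?h (b \<otimes> a)" using ab by simp
    then show ?thesis using ab' PG h.hom_mult by (metis subsetD)
  qed
  \<comment> \<open>The preimage \<open>?U\<close> of \<open>T\<close> has order |T| |K|, again
    prime to p, so maximality of \<open>K\<close> leaves |T| = 1.\<close>
  have noQ: "T = {\<one>\<^bsub>G Mod K\<^esub>}" if T: "T \<lhd> G Mod K" "\<not> p dvd card T" for T
  proof -
    have Tsub: "subgroup T (G Mod K)" using T(1) by (rule normal_imp_subgroup)
    let ?U = "\<Union>T"
    have U: "?U \<lhd> G" by (rule K.factgroup_subgroup_union_normal[OF T(1)])
    then have Usub: "subgroup ?U G" by (rule normal_imp_subgroup)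
    have "K \<in> T" using subgroup.one_closed[OF Tsub] by simp
    then have "K \<subseteq> ?U" by blast
    then have "subgroup K (G\<lparr>carrier := ?U\<rparr>)" using subgroup_incl[OF Ksub Usub] by blast
    then have "card T * card K = card ?U"
      using group.lagrange[OF subgroup_imp_group[OF Usub], of K] K.factgroup_subgroup_union_factor[OF Tsub]
      by (simp add: order_def)
    moreover have "card ?U \<le> card K"
    proof (rule max[OF U])
      show "\<not> p dvd card ?U" using calculation T(2) K(2) p by (metis prime_dvd_mult_iff)
    qed
    ultimately have "card T \<le> 1" using Kpos by (metis mult_le_cancel2 nat_mult_1)
    moreover have "finite T" using finQ subgroup.subset[OF Tsub] finite_subset by blast
    ultimately have "\<forall>X\<in>T. \<forall>Y\<in>T. X = Y" using card_le_Suc0_iff_eq[of T] by simp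
    then show ?thesis using \<open>K \<in> T\<close> by auto
  qed
  have PN: "?h ` P \<lhd> G Mod K"
    by (rule Q.abelian_sylow_normal[OF finQ solQ p PQ cardPQ ndQ abQ noQ])
  have KPs: "subgroup (K <#> P) G" by (rule mult_norm_subgroup[OF K(1) P(1)])
  have sub: "P \<subseteq> K <#> P" by (rule subset_set_mult_right[OF PG subgroup.one_closed[OF Ksub]])
  have KPn: "K <#> P \<lhd> G"
  proof (rule normal_invI[OF KPs])
    fix x h assume x: "x \<in> carrier G" and h: "h \<in> K <#> P"
    then obtain k y where ky: "k \<in> K" "y \<in> P" "h = k \<otimes> y" by (auto simp: set_mult_def)
    have G: "k \<in> carrier G" "y \<in> carrier G" using ky KG PG by blast+
    have "?h x \<otimes>\<^bsub>G Mod K\<^esub> ?h y \<otimes>\<^bsub>G Mod K\<^esub> inv\<^bsub>G Mod K\<^esub> ?h x \<in> ?h ` P"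
      using PN Q.normal_inv_iff x ky(2) h.hom_closed by blast
    then have "?h (x \<otimes> y \<otimes> inv x) \<in> ?h ` P" using x G by simp
    then obtain z where z: "z \<in> P" "K #> (x \<otimes> y \<otimes> inv x) = K #> z" by blast
    then have "x \<otimes> y \<otimes> inv x \<in> K #> z" using rcos_self[OF _ Ksub, of "x \<otimes> y \<otimes> inv x"] x G by simp
    then have "x \<otimes> y \<otimes> inv x \<in> K <#> P" using z(1) by (auto simp: set_mult_def r_coset_def)
    moreover have "x \<otimes> k \<otimes> inv x \<in> K <#> P"
    proof -
      have "x \<otimes> k \<otimes> inv x \<in> K" using K.inv_op_closed2 x ky(1) by blast
      then have "(x \<otimes> k \<otimes> inv x) \<otimes> \<one> \<in> K <#> P" using subgroup.one_closed[OF P(1)] unfolding set_mult_def by blast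
      then show ?thesis using x G by simp
    qed
    ultimately show "x \<otimes> h \<otimes> inv x \<in> K <#> P"
      using conj_mult[OF x G] ky(3) subgroup.m_closed[OF KPs] by simp
  qed
  have "p ^ n dvd card (K <#> P)" using card_subgroup_dvd[OF P(1) KPs sub] P(2) by simp
  then have "self_normalizing (K <#> P) G"
    using abnormal_imp_self_normalizing[OF fin]
      abnormal_if_contains_self_normalizing_p_subgroup[OF fin p P N KPs] by blast
  then have "K <#> P = carrier G" by (rule normal_self_normalizing_eq_carrier[OF fin KPn])
  then show ?thesis using that K by blast
qed

text \<open>Every coset of \<open>K\<close> has a representative in \<open>P\<close>, so G/K
  inherits commutativity from \<open>P\<close>.\<close>

lemma (in group) derived_subset_if_abelian_supplement:
  assumes K: "K \<lhd> G" and P: "subgroup P G" and KP: "K <#> P = carrier G"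
    and ab: "\<And>a b. a \<in> P \<Longrightarrow> b \<in> P \<Longrightarrow> a \<otimes> b = b \<otimes> a"
  shows "derived G (carrier G) \<subseteq> K"
proof (rule derived_minimal[OF K])
  interpret K: normal K G by (rule K)
  have PG: "P \<subseteq> carrier G" using P subgroup.subset by blast
  interpret h: group_hom G "G Mod K" "\<lambda>a. K #> a"
    unfolding group_hom_def group_hom_axioms_def
    by (simp add: K.factorgroup_is_group K.r_coset_hom_Mod)
  have rep: "\<exists>y\<in>P. X = K #> y" if X: "X \<in> carrier (G Mod K)" for X
  proof -
    obtain g where g: "g \<in> carrier G" "X = K #> g" using X by (auto simp: carrier_FactGroup)
    then have "g \<in> K <#> P" using KP by simp
    then obtain k y where ky: "k \<in> K" "y \<in> P" "g = k \<otimes> y" by (auto simp: set_mult_def)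
    then have "g \<in> K #> y" by (auto simp: r_coset_def)
    then have "K #> g = K #> y" using repr_independence[of g K y] ky PG K.subgroup_axioms by auto
    then show ?thesis using ky g by blast
  qed
  show "comm_group (G Mod K)"
  proof (rule group.group_comm_groupI[OF K.factorgroup_is_group])
    fix X Y assume "X \<in> carrier (G Mod K)" "Y \<in> carrier (G Mod K)"
    then obtain a b where ab': "a \<in> P" "b \<in> P" "X = K #> a" "Y = K #> b" using rep by blast
    then have "K #> (a \<otimes> b) = K #> (b \<otimes> a)" using ab by simp
    then show "X \<otimes>\<^bsub>G Mod K\<^esub> Y = Y \<otimes>\<^bsub>G Mod K\<^esub> X"
      using ab' PG h.hom_mult[of a b] h.hom_mult[of b a] by (simp add: subset_iff)
  qed
qed

lemma (in group) normal_if_derived_subset: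
  assumes H: "subgroup H G" and d: "derived G (carrier G) \<subseteq> H"
  shows "H \<lhd> G"
proof (rule normal_invI[OF H])
  fix x h assume x: "x \<in> carrier G" and h: "h \<in> H"
  have hG: "h \<in> carrier G" using h H by (rule subgroup.mem_carrier[rotated])
  have "x \<otimes> h \<otimes> inv x \<otimes> inv h \<in> derived_set G (carrier G)" using x hG by blast
  then have "x \<otimes> h \<otimes> inv x \<otimes> inv h \<in> derived G (carrier G)" unfolding derived_def by (rule generate.incl)
  then have "x \<otimes> h \<otimes> inv x \<otimes> inv h \<in> H" using d by blast
  then have "(x \<otimes> h \<otimes> inv x \<otimes> inv h) \<otimes> h \<in> H" using h subgroup.m_closed[OF H] by blast
  then show "x \<otimes> h \<otimes> inv x \<in> H" using x hG by (simp add: m_assoc)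
qed

text \<open>The supplement \<open>K\<close> serves only to bound \<open>?D\<close>: it shows that
  the order of \<open>?D\<close> is prime to p. That \<open>?D <#> P\<close> is everything follows
  anew, since it is normal for containing \<open>?D\<close> and self-normalizing for containing
  \<open>P\<close>.\<close>

lemma (in group) derived_complement_of_self_normalizing:
  fixes p :: nat
  assumes fin: "finite (carrier G)" and sol: "solvable G" and p: "prime p"
    and P: "subgroup P G" "card P = p ^ n" and N: "normalizer G P = P"
    and ab: "\<And>a b. a \<in> P \<Longrightarrow> b \<in> P \<Longrightarrow> a \<otimes> b = b \<otimes> a"
  shows "semidirect G (derived G (carrier G)) P"
proof -
  let ?D = "derived G (carrier G)"
  have PG: "P \<subseteq> carrier G" using P(1) subgroup.subset by blast
  obtain K where K: "K \<lhd> G" "\<not> p dvd card K" "K <#> P = carrier G"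
    using normal_coprime_supplement[OF fin sol p P N ab] by blast
  have D: "?D \<lhd> G" by (rule derived_self_is_normal)
  have Dsub: "subgroup ?D G" using D by (rule normal_imp_subgroup)
  have Ksub: "subgroup K G" using K(1) by (rule normal_imp_subgroup)
  have DK: "?D \<subseteq> K" by (rule derived_subset_if_abelian_supplement[OF K(1) P(1) K(3) ab])
  have "card ?D dvd card K" by (rule card_subgroup_dvd[OF Dsub Ksub DK])
  then have "\<not> p dvd card ?D" using K(2) dvd_trans by blast
  then have "coprime (card ?D) (card P)"
    using p P(2) by (simp add: coprime_commute prime_imp_coprime)
  then have i: "?D \<inter> P = {\<one>}" by (rule coprime_subgroups_Int[OF Dsub P(1)])
  have DPs: "subgroup (?D <#> P) G" by (rule mult_norm_subgroup[OF D P(1)])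
  have sub: "P \<subseteq> ?D <#> P" 
    by (rule subset_set_mult_right[OF PG subgroup.one_closed[OF Dsub]])
  have "?D \<subseteq> ?D <#> P" 
    by (rule subset_set_mult_left[OF subgroup.subset[OF Dsub] subgroup.one_closed[OF P(1)]])
  then have DPn: "?D <#> P \<lhd> G" by (rule normal_if_derived_subset[OF DPs])
  have "p ^ n dvd card (?D <#> P)" using card_subgroup_dvd[OF P(1) DPs sub] P(2) by simp
  then have "self_normalizing (?D <#> P) G"
    using abnormal_imp_self_normalizing[OF fin]
      abnormal_if_contains_self_normalizing_p_subgroup[OF fin p P N DPs] by blast
  then have "?D <#> P = carrier G" by (rule normal_self_normalizing_eq_carrier[OF fin DPn])
  then show "semidirect G ?D P" using D P(1) i by (simp add: semidirect_def)
qed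

subsection \<open>Formations and subnormal chains\<close>

lemma ex_maximal_subgroup:
  assumes "finite (carrier G)" "subgroup A G" "A \<noteq> carrier G"
  obtains M where "maximal_subgroup M G" "A \<subseteq> M"
proof -
  define X where "X = {M. subgroup M G \<and> A \<subseteq> M \<and> M \<noteq> carrier G}"
  have "finite X"
    by (rule finite_subset[of _ "Pow (carrier G)"])
      (use assms(1) in \<open>auto simp: X_def dest: subgroup.subset\<close>)
  moreover have "A \<in> X" using assms by (simp add: X_def)
  ultimately obtain M where M: "M \<in> X" "\<forall>L\<in>X. M \<subseteq> L \<longrightarrow> M = L"
    using finite_has_maximal2[of X A] by metis
  have "K = M \<or> K = carrier G" if "subgroup K G" "M \<subseteq> K" for K
  proof (rule disjCI)
    assume "K \<noteq> carrier G"
    then have "K \<in> X" using that M(1) by (auto simp: X_def)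
    then show "K = M" using M(2) that(2) by metis
  qed
  then have "maximal_subgroup M G" using M(1) by (simp add: maximal_subgroup_def X_def)
  then show ?thesis using that M(1) by (auto simp: X_def)
qed

lemma (in group) core_in_carrier_iff:
  assumes "subgroup U G"
  shows "g \<in> core_in G U (carrier G) \<longleftrightarrow> g \<in> carrier G \<and> (\<forall>x\<in>carrier G. x \<otimes> g \<otimes> inv x \<in> U)"
  using mem_conj_subgroup_iff[OF _ subgroup.subset[OF assms]] one_closed
  unfolding core_in_def by blast

lemma (in group) core_in_normal:
  assumes U: "subgroup U G"
  shows "core_in G U (carrier G) \<lhd> G"
proof (rule normal_invI)
  note iff = core_in_carrier_iff[OF U]
  show "subgroup (core_in G U (carrier G)) G"
  proof (rule subgroupI)
    show "core_in G U (carrier G) \<subseteq> carrier G" using iff by blast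
    have "\<one> \<in> core_in G U (carrier G)" using iff U by (simp add: subgroup.one_closed)
    then show "core_in G U (carrier G) \<noteq> {}" by blast
    show "inv a \<in> core_in G U (carrier G)" if a: "a \<in> core_in G U (carrier G)" for a
    proof -
      have "x \<otimes> inv a \<otimes> inv x = inv (x \<otimes> a \<otimes> inv x)" if "x \<in> carrier G" for x
        using that a iff by (simp add: inv_mult_group m_assoc)
      then show ?thesis using a subgroup.m_inv_closed[OF U] iff by simp
    qed
    show "a \<otimes> b \<in> core_in G U (carrier G)"
      if "a \<in> core_in G U (carrier G)" "b \<in> core_in G U (carrier G)" for a b
      using that conj_mult[of _ a b] subgroup.m_closed[OF U] iff by simp
  qed
  show "x \<otimes> h \<otimes> inv x \<in> core_in G U (carrier G)"
    if "x \<in> carrier G" "h \<in> core_in G U (carrier G)" for x h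
    using that conj_conj[of _ x h] iff by simp
qed

lemma (in group) core_in_subset:
  assumes "subgroup U G" shows "core_in G U (carrier G) \<subseteq> U"
proof
  fix g assume "g \<in> core_in G U (carrier G)"
  then have "g \<in> carrier G" "\<one> \<otimes> g \<otimes> inv \<one> \<in> U"
    using core_in_carrier_iff[OF assms] one_closed by blast+
  then show "g \<in> U" by simp
qed

lemma (in group) normal_subset_core_in:
  assumes "subgroup U G" "N \<lhd> G" "N \<subseteq> U" shows "N \<subseteq> core_in G U (carrier G)"
proof
  fix g assume g: "g \<in> N"
  then have "g \<in> carrier G" using assms(2) by (meson normal_imp_subgroup subgroup.mem_carrier)
  moreover have "x \<otimes> g \<otimes> inv x \<in> U" if "x \<in> carrier G" for x
    using normal.inv_op_closed2[OF assms(2) that g] assms(3) by blast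
  ultimately show "g \<in> core_in G U (carrier G)" using core_in_carrier_iff[OF assms(1)] by blast
qed

text \<open>\<open>F_subnormal\<close> computes the core of each link with the operations of
  \<open>G\<close>, whereas the facts about cores above are stated for the carrier of a group; this
  passes between the two.\<close>

lemma (in group) core_in_consistent:
  assumes "subgroup B G" "A \<subseteq> B"
  shows "core_in (G\<lparr>carrier := B\<rparr>) A B = core_in G A B"
  using assms by (simp add: core_in_def conj_subgroup_def m_inv_consistent)

text \<open>Class membership refers to groups on \<open>nat\<close>. The structure is carried along
  an injection of the carrier, viewed as a weak morphism whose fibres are the cosets of the trivial
  subgroup.\<close>

lemma (in group) ex_nat_copy:
  assumes "finite (carrier G)"
  obtains K :: "nat monoid" where "group K" "finite (carrier K)" "G \<cong> K"
proof -
  obtain f :: "'a \<Rightarrow> nat" where f: "inj_on f (carrier G)"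
    using assms finite_imp_inj_to_nat_seg by blast
  have w: "weak_group_morphism f {\<one>} G"
  proof (rule weak_group_morphismsI[OF one_is_normal])
    fix a b assume ab: "a \<in> carrier G" "b \<in> carrier G"
    have "a \<otimes> inv b = \<one> \<longleftrightarrow> a = b" using ab by (metis inv_closed inv_equality inv_inv r_inv)
    then show "f a = f b \<longleftrightarrow> a \<otimes> inv b \<in> {\<one>}" using f ab by (auto dest: inj_onD)
  qed
  let ?K = "image_group f G"
  have c: "carrier ?K = f ` carrier G" by (rule image_group_carrier)
  have "f \<in> iso G ?K"
    using weak_group_morphism_is_hom[OF w] f c by (simp add: iso_iff)
  then show ?thesis
    using that[of ?K] image_group_is_group[OF w] c assms by (auto dest: is_isoI)
qed

lemma (in comm_group) nilpotent: "nilpotent_group G"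
proof -
  have "(\<Union>x\<in>carrier G. \<Union>y\<in>carrier G. {x \<otimes> y \<otimes> inv x \<otimes> inv y}) = {\<one>}"
  proof -
    have "x \<otimes> y \<otimes> inv x \<otimes> inv y = \<one>" if "x \<in> carrier G" "y \<in> carrier G" for x y
    proof -
      have "x \<otimes> y \<otimes> inv x = y" using that by (metis inv_solve_right m_closed m_comm)
      then show ?thesis using that by simp
    qed
    then show ?thesis using one_closed by auto
  qed
  then have "lower_central G 1 = {\<one>}" by (simp add: generate_one)
  then show ?thesis unfolding nilpotent_group_def using is_group by blast
qed

lemma abelian_in_nilpotent_class:
  assumes "comm_group X" "finite (carrier X)"
  shows "in_class X nilpotent_class"
proof -
  interpret X: comm_group X by fact
  obtain K :: "nat monoid" where K: "group K" "finite (carrier K)" "X \<cong> K"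
    using X.ex_nat_copy[OF assms(2)] by blast
  then have "comm_group K" using X.iso_imp_comm_group group.is_monoid by blast
  then have "K \<in> nilpotent_class" using K comm_group.nilpotent by (auto simp: nilpotent_class_def)
  then show ?thesis using K X.is_group unfolding in_class_def by blast
qed

text \<open>
  For a subgroup \<open>U\<close> of \<open>V\<close>, \<open>kernel_below F U V\<close> says that the quotient of \<open>V\<close> by the core of \<open>U\<close>
  lies in \<open>F\<close>. In this form it restricts to subgroups of \<open>V\<close> without the isomorphism theorems.
  Maximality plays no role in \<open>subnormal_step\<close>: chains of such steps can be refined to chains of
  maximal subgroups.
\<close>

definition kernel_below :: "nat monoid set \<Rightarrow> 'a set \<Rightarrow> ('a, 'b) monoid_scheme \<Rightarrow> bool" where
  "kernel_below F U V \<longleftrightarrow> (\<exists>K\<in>F. \<exists>h\<in>hom V K. kernel V K h \<subseteq> U)"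

definition subnormal_step :: "nat monoid set \<Rightarrow> ('a, 'b) monoid_scheme \<Rightarrow> ('a set \<times> 'a set) set" where
  "subnormal_step F G =
     {(A, B). subgroup A G \<and> subgroup B G \<and> A \<subseteq> B \<and> kernel_below F A (G\<lparr>carrier := B\<rparr>)}"

section \<open>Class membership up to isomorphism and F-subnormal chains\<close>

locale subgroup_closed_formation =
  fixes F :: "nat monoid set"
  assumes formation: "formation F" and subgroup_closed: "subgroup_closed F"
    and nilpotent: "nilpotent_class \<subseteq> F"
begin

lemma group_mem: "K \<in> F \<Longrightarrow> group K"
  using formation by (auto simp: formation_def group_class_def)

lemma in_class_iso:
  assumes "in_class X F" "group Y" "Y \<cong> X" shows "in_class Y F"
  using assms iso_trans unfolding in_class_def by blast

lemma in_class_mem_iff: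
  fixes K :: "nat monoid"
  shows "in_class K F \<longleftrightarrow> K \<in> F"
proof
  assume "in_class K F"
  then obtain L where L: "L \<in> F" "K \<cong> L" "group K" by (auto simp: in_class_def)
  then have "L \<cong> K" by (simp add: group.iso_sym)
  moreover have "\<forall>G\<in>F. \<forall>K :: nat monoid. group K \<and> G \<cong> K \<longrightarrow> K \<in> F"
    using formation unfolding formation_def group_class_def by (elim conjE)
  ultimately show "K \<in> F" using L by blast
next
  assume "K \<in> F"
  then show "in_class K F" unfolding in_class_def using group_mem iso_refl by blast
qed

lemma in_class_subgroup:
  assumes X: "in_class X F" and H: "subgroup H X"
  shows "in_class (X\<lparr>carrier := H\<rparr>) F"
proof -
  obtain K where K: "K \<in> F" "X \<cong> K" and g: "group X" using X by (auto simp: in_class_def)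
  then obtain f where f: "f \<in> iso X K" by (auto simp: is_iso_def)
  have gK: "group K" using K(1) by (rule group_mem)
  have "K\<lparr>carrier := f ` H\<rparr> \<in> F"
    using subgroup.iso_subgroup[OF H g gK f] K(1) subgroup_closed by (auto simp: subgroup_closed_def)
  moreover have "X\<lparr>carrier := H\<rparr> \<cong> K\<lparr>carrier := f ` H\<rparr>"
    using iso_restrict[OF f g gK H] by (rule is_isoI)
  ultimately show ?thesis using group.subgroup_imp_group[OF g H] unfolding in_class_def by blast
qed

lemma in_class_mono:
  assumes Y: "in_class Y F" and X: "group X" and h: "h \<in> hom X Y" "inj_on h (carrier X)"
  shows "in_class X F"
proof -
  interpret h: group_hom X Y h
    using X Y h by (simp add: group_hom_def group_hom_axioms_def in_class_def)
  have "h \<in> hom X (Y\<lparr>carrier := h ` carrier X\<rparr>)" using h by (auto simp: hom_def)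
  then have "h \<in> iso X (Y\<lparr>carrier := h ` carrier X\<rparr>)" using h(2) by (simp add: iso_iff)
  then show ?thesis
    using in_class_iso[OF in_class_subgroup[OF Y h.img_is_subgroup] X] is_isoI by blast
qed

text \<open>The closure axiom speaks of quotients of members only, so the epimorphism is pulled back
  to a member \<open>K\<close>, and the first isomorphism theorem identifies \<open>Y\<close> with a
  quotient of \<open>K\<close>.\<close>

lemma in_class_epi:
  assumes X: "in_class X F" and Y: "group Y" and h: "h \<in> hom X Y" "h ` carrier X = carrier Y"
  shows "in_class Y F"
proof -
  obtain K where K: "K \<in> F" "X \<cong> K" and g: "group X" using X by (auto simp: in_class_def)
  then have "K \<cong> X" by (simp add: group.iso_sym)
  then obtain f where f: "f \<in> iso K X" by (auto simp: is_iso_def)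
  have gK: "group K" using K(1) by (rule group_mem)
  have hom: "h \<circ> f \<in> hom K Y" using f h by (meson Group.hom_compose Group.iso_iff)
  interpret h: group_hom K Y "h \<circ> f"
    using gK Y hom by (simp add: group_hom_def group_hom_axioms_def)
  have "(h \<circ> f) ` carrier K = carrier Y" using f h by (simp only: Group.iso_iff image_comp[symmetric])
  then have "K Mod kernel K Y (h \<circ> f) \<cong> Y" by (rule h.FactGroup_iso)
  moreover have "in_class (K Mod kernel K Y (h \<circ> f)) F"
    using formation K(1) h.normal_kernel unfolding formation_def by blast
  ultimately show ?thesis
    using in_class_iso[OF _ Y] group.iso_sym unfolding in_class_def by blast
qed

text \<open>The quotient by the kernel embeds into \<open>K\<close>, so subgroup closure applies to
  it; G/N is an image of that quotient.\<close>

lemma in_class_quotient_if_kernel_subset: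
  assumes G: "group G" and K: "K \<in> F" and h: "h \<in> hom G K" and N: "N \<lhd> G" "kernel G K h \<subseteq> N"
  shows "in_class (G Mod N) F"
proof -
  interpret G: group G by (rule G)
  interpret h: group_hom G K h
    using G h group_mem[OF K] by (simp add: group_hom_def group_hom_axioms_def)
  interpret N: normal N G by (rule N(1))
  interpret p: group_hom G "G Mod N" "\<lambda>a. N #>\<^bsub>G\<^esub> a"
    unfolding group_hom_def group_hom_axioms_def
    by (simp add: G N.factorgroup_is_group N.r_coset_hom_Mod)
  have ker: "kernel G K h \<subseteq> kernel G (G Mod N) (\<lambda>a. N #>\<^bsub>G\<^esub> a)"
    using N(2) N.rcos_const[OF G] by (auto simp: kernel_def)
  obtain q where q: "q \<in> hom (G Mod kernel G K h) (G Mod N)"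
      "\<And>x. x \<in> carrier G \<Longrightarrow> q (kernel G K h #>\<^bsub>G\<^esub> x) = N #>\<^bsub>G\<^esub> x"
    using p.FactGroup_universal_kernel[OF h.normal_kernel ker] by blast
  have gk: "group (G Mod kernel G K h)" by (rule normal.factorgroup_is_group[OF h.normal_kernel])
  have "in_class (G Mod kernel G K h) F"
    using in_class_mono[OF _ gk h.FactGroup_hom h.FactGroup_inj_on] K by (simp add: in_class_mem_iff)
  moreover have "q ` carrier (G Mod kernel G K h) = carrier (G Mod N)"
    using q(2) by (auto simp: carrier_FactGroup image_image)
  ultimately show ?thesis by (rule in_class_epi[OF _ N.factorgroup_is_group q(1)])
qed

lemma kernel_below_if_quotient:
  assumes N: "N \<lhd> G" and c: "in_class (G Mod N) F" and NU: "N \<subseteq> U"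
  shows "kernel_below F U G"
proof -
  interpret N: normal N G by (rule N)
  obtain K f where K: "K \<in> F" and f: "f \<in> iso (G Mod N) K" using c by (auto simp: in_class_def is_iso_def)
  let ?h = "f \<circ> (\<lambda>a. N #>\<^bsub>G\<^esub> a)"
  have "?h \<in> hom G K" using f N.r_coset_hom_Mod by (meson Group.hom_compose Group.iso_iff)
  moreover have "kernel G K ?h \<subseteq> U"
  proof
    fix a assume "a \<in> kernel G K ?h"
    then have a: "a \<in> carrier G" "f (N #>\<^bsub>G\<^esub> a) = \<one>\<^bsub>K\<^esub>" by (auto simp: kernel_def)
    then have "f (N #>\<^bsub>G\<^esub> a) = f N"
      using f hom_one[of f "G Mod N" K] N.factorgroup_is_group group_mem[OF K] by (simp add: Group.iso_iff)
    moreover have "N \<in> carrier (G Mod N)"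
      using group.is_monoid[OF N.factorgroup_is_group] monoid.one_closed by fastforce
    moreover have "N #>\<^bsub>G\<^esub> a \<in> carrier (G Mod N)" using a by (auto simp: carrier_FactGroup)
    ultimately have "N #>\<^bsub>G\<^esub> a = N" using f by (meson Group.iso_iff inj_onD)
    then have "a \<in> N" using N.coset_join1 a(1) N.subgroup_axioms by blast
    then show "a \<in> U" using NU by blast
  qed
  ultimately show ?thesis using K by (auto simp: kernel_below_def)
qed

text \<open>The core is the largest normal subgroup inside \<open>U\<close>, so it contains every
  kernel that lies in \<open>U\<close>.\<close>

lemma in_class_core_iff:
  assumes G: "group G" and U: "subgroup U G"
  shows "in_class (G Mod core_in G U (carrier G)) F \<longleftrightarrow> kernel_below F U G"
proof
  interpret G: group G by (rule G)
  let ?C = "core_in G U (carrier G)"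
  have C: "?C \<lhd> G" by (rule G.core_in_normal[OF U])
  {
    assume "in_class (G Mod ?C) F"
    then show "kernel_below F U G" by (rule kernel_below_if_quotient[OF C _ G.core_in_subset[OF U]])
  next
    assume "kernel_below F U G"
    then obtain K h where K: "K \<in> F" and h: "h \<in> hom G K" "kernel G K h \<subseteq> U" by (auto simp: kernel_below_def)
    interpret h: group_hom G K h
      using G h group_mem[OF K] by (simp add: group_hom_def group_hom_axioms_def)
    have "kernel G K h \<subseteq> ?C" by (rule G.normal_subset_core_in[OF U h.normal_kernel h(2)])
    then show "in_class (G Mod ?C) F"
      by (rule in_class_quotient_if_kernel_subset[OF G K h(1) C])
  }
qed

lemma kernel_below_restrict:
  assumes G: "group G" and S: "subgroup S G" and UV: "U \<inter> S \<subseteq> U'" and k: "kernel_below F U G"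
  shows "kernel_below F U' (G\<lparr>carrier := S\<rparr>)"
proof -
  obtain K h where K: "K \<in> F" and h: "h \<in> hom G K" "kernel G K h \<subseteq> U" using k by (auto simp: kernel_below_def)
  have SG: "S \<subseteq> carrier G" using S by (rule subgroup.subset)
  have "h \<in> hom (G\<lparr>carrier := S\<rparr>) K" using h(1) SG by (auto simp: hom_def)
  moreover have "kernel (G\<lparr>carrier := S\<rparr>) K h \<subseteq> U'" using h(2) SG UV by (auto simp: kernel_def)
  ultimately show ?thesis using K by (auto simp: kernel_below_def)
qed

text \<open>Left to right, each link of a chain is a step. Conversely, a step is refined to maximal
  links by inserting maximal subgroups from the top.\<close>

lemma F_subnormal_iff_steps:
  assumes G: "group G" and fin: "finite (carrier G)"
  shows "F_subnormal F H G \<longleftrightarrow> (H, carrier G) \<in> (subnormal_step F G)\<^sup>*"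
proof -
  interpret G: group G by (rule G)
  let ?R = "{(A, B). maximal_subgroup A (G\<lparr>carrier := B\<rparr>) \<and>
               in_class (G\<lparr>carrier := B\<rparr> Mod core_in G A B) F}"
  have R: "F_subnormal F H G \<longleftrightarrow> (H, carrier G) \<in> ?R\<^sup>*"
  proof
    assume "F_subnormal F H G"
    then show "(H, carrier G) \<in> ?R\<^sup>*"
      unfolding F_subnormal_def
    proof (elim disjE exE)
      fix n C assume "C 0 = H \<and> C n = carrier G \<and> (\<forall>i<n. maximal_subgroup (C i) (G\<lparr>carrier := C (Suc i)\<rparr>) \<and>
               in_class (G\<lparr>carrier := C (Suc i)\<rparr> Mod core_in G (C i) (C (Suc i))) F)"
      then have "(H, carrier G) \<in> ?R ^^ n" unfolding relpow_fun_conv by (intro exI[of _ C]) auto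
      then show ?thesis by (rule relpow_imp_rtrancl)
    qed simp
  next
    assume "(H, carrier G) \<in> ?R\<^sup>*"
    then obtain n where "(H, carrier G) \<in> ?R ^^ n" by (auto simp: rtrancl_power)
    then obtain C where "C 0 = H" "C n = carrier G" "\<forall>i<n. (C i, C (Suc i)) \<in> ?R"
      unfolding relpow_fun_conv by blast
    then show "F_subnormal F H G" unfolding F_subnormal_def by blast
  qed
  have core: "in_class (G\<lparr>carrier := B\<rparr> Mod core_in G A B) F \<longleftrightarrow> kernel_below F A (G\<lparr>carrier := B\<rparr>)"
    if B: "subgroup B G" and A: "subgroup A (G\<lparr>carrier := B\<rparr>)" for A B
    using in_class_core_iff[OF G.subgroup_imp_group[OF B] A] G.core_in_consistent[OF B] subgroup.subset[OF A]
    by simp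
  \<comment> \<open>Maximality of a link speaks about the next term only. That all terms are
    subgroups of \<open>G\<close> is carried down from the top, hence the converse
    induction.\<close>
  have "subgroup H G \<and> (H, carrier G) \<in> (subnormal_step F G)\<^sup>*" if "(H, carrier G) \<in> ?R\<^sup>*"
    using that
  proof (induction rule: converse_rtrancl_induct)
    case base
    then show ?case by (simp add: G.subgroup_self)
  next
    case (step A B)
    then have m: "subgroup A (G\<lparr>carrier := B\<rparr>)" and B: "subgroup B G"
      by (auto simp: maximal_subgroup_def)
    then have "kernel_below F A (G\<lparr>carrier := B\<rparr>)" using step core by blast
    moreover have "A \<subseteq> B" using subgroup.subset[OF m] by simp
    moreover have A: "subgroup A G" by (rule G.incl_subgroup[OF B m])
    ultimately have "(A, B) \<in> subnormal_step F G" using B by (simp add: subnormal_step_def)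
    then show ?case using step A by (meson converse_rtrancl_into_rtrancl)
  qed
  moreover have "(H, carrier G) \<in> ?R\<^sup>*" if "(H, carrier G) \<in> (subnormal_step F G)\<^sup>*"
  proof -
    have "(A, B) \<in> ?R\<^sup>*" if "(A, B) \<in> subnormal_step F G" for A B
      using that
    \<comment> \<open>Choose a maximal subgroup \<open>M\<close> of \<open>B\<close> above
      \<open>A\<close>. The kernel inside \<open>A\<close> is also inside \<open>M\<close>, so
      \<open>M\<close> in \<open>B\<close> is a genuine link; restricting the homomorphism to
      \<open>M\<close> makes \<open>A\<close> in \<open>M\<close> a step with a smaller top.\<close>
    proof (induction "card B" arbitrary: B rule: less_induct)
      case less
      then have A: "subgroup A G" and B: "subgroup B G" and AB: "A \<subseteq> B"
        and k: "kernel_below F A (G\<lparr>carrier := B\<rparr>)" by (auto simp: subnormal_step_def)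
      interpret B: group "G\<lparr>carrier := B\<rparr>" by (rule G.subgroup_imp_group[OF B])
      have finB: "finite B" using subgroup.subset[OF B] fin finite_subset by blast
      show ?case
      proof (cases "A = B")
        case False
        have sAB: "subgroup A (G\<lparr>carrier := B\<rparr>)" by (rule G.subgroup_incl[OF A B AB])
        obtain M where M: "maximal_subgroup M (G\<lparr>carrier := B\<rparr>)" "A \<subseteq> M"
          using ex_maximal_subgroup[OF _ sAB] finB False by auto
        have Msub: "subgroup M (G\<lparr>carrier := B\<rparr>)" using M(1) by (simp add: maximal_subgroup_def)
        have MG: "subgroup M G" by (rule G.incl_subgroup[OF B Msub])
        have MB: "M \<subset> B" using M(1) subgroup.subset[OF Msub] by (auto simp: maximal_subgroup_def)
        have "kernel_below F M (G\<lparr>carrier := B\<rparr>)" using k M(2) by (auto simp: kernel_below_def)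
        then have "(M, B) \<in> ?R" using M(1) core[OF B Msub] by simp
        moreover have "kernel_below F A (G\<lparr>carrier := M\<rparr>)"
          using kernel_below_restrict[OF B.is_group Msub _ k] by simp
        then have "(A, M) \<in> subnormal_step F G" using A MG M(2) by (simp add: subnormal_step_def)
        then have "(A, M) \<in> ?R\<^sup>*" using less(1)[of M] psubset_card_mono[OF finB MB] by blast
        ultimately show ?thesis by (meson rtrancl.rtrancl_into_rtrancl)
      qed simp
    qed
    then have "subnormal_step F G \<subseteq> ?R\<^sup>*" by (intro subrelI)
    from subsetD[OF rtrancl_subset_rtrancl[OF this] that] show ?thesis .
  qed
  ultimately show ?thesis using R by blast
qed

text \<open>Intersect every term with \<open>S\<close>. The new terms need not be maximal in one
  another, but restricted homomorphisms still witness each step, and these can be refined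
  again.\<close>

lemma F_subnormal_Int:
  assumes G: "group G" and fin: "finite (carrier G)" and S: "subgroup S G" and H: "F_subnormal F H G"
  shows "F_subnormal F (H \<inter> S) (G\<lparr>carrier := S\<rparr>)"
proof -
  interpret G: group G by (rule G)
  interpret S: group "G\<lparr>carrier := S\<rparr>" by (rule G.subgroup_imp_group[OF S])
  have SG: "S \<subseteq> carrier G" using S by (rule subgroup.subset)
  have lift: "(A \<inter> S, B \<inter> S) \<in> subnormal_step F (G\<lparr>carrier := S\<rparr>)" if "(A, B) \<in> subnormal_step F G" for A B
  proof -
    have A: "subgroup A G" and B: "subgroup B G" and AB: "A \<subseteq> B"
      and k: "kernel_below F A (G\<lparr>carrier := B\<rparr>)" using that by (auto simp: subnormal_step_def)
    have "subgroup (B \<inter> S) (G\<lparr>carrier := B\<rparr>)"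
      using G.subgroup_incl[OF G.subgroups_Inter_pair[OF B S] B] by simp
    then have "kernel_below F (A \<inter> S) (G\<lparr>carrier := B \<inter> S\<rparr>)"
      using kernel_below_restrict[OF G.subgroup_imp_group[OF B] _ _ k, of "B \<inter> S" "A \<inter> S"] by auto
    moreover have "subgroup (A \<inter> S) (G\<lparr>carrier := S\<rparr>)" "subgroup (B \<inter> S) (G\<lparr>carrier := S\<rparr>)"
      using G.subgroup_incl[OF G.subgroups_Inter_pair[OF _ S] S] A B by auto
    ultimately show ?thesis using AB by (auto simp: subnormal_step_def)
  qed
  have "(H, carrier G) \<in> (subnormal_step F G)\<^sup>*" using F_subnormal_iff_steps[OF G fin] H by blast
  then have "(H \<inter> S, carrier G \<inter> S) \<in> (subnormal_step F (G\<lparr>carrier := S\<rparr>))\<^sup>*"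
    by (induction rule: rtrancl_induct) (auto intro: rtrancl.rtrancl_into_rtrancl lift)
  moreover have "carrier G \<inter> S = S" using SG by blast
  ultimately show ?thesis
    using F_subnormal_iff_steps[OF S.is_group] finite_subset[OF SG fin] by simp
qed

lemma in_class_abelian:
  assumes "comm_group X" "finite (carrier X)"
  shows "in_class X F"
  using abelian_in_nilpotent_class[OF assms] nilpotent unfolding in_class_def by blast

lemma kernel_below_if_derived_subset:
  assumes G: "group G" and fin: "finite (carrier G)" and d: "derived G (carrier G) \<subseteq> U"
  shows "kernel_below F U G"
proof (rule kernel_below_if_quotient[OF group.derived_self_is_normal[OF G] _ d])
  show "in_class (G Mod derived G (carrier G)) F"
    using group.derived_quot_is_comm_group[OF G]
    by (rule in_class_abelian) (use fin in \<open>simp add: carrier_FactGroup\<close>)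
qed

end

lemma F_subnormal_imp_maximal:
  assumes H: "F_subnormal F H G" "H \<noteq> carrier G" and G: "group G"
  obtains M where "maximal_subgroup M G" "in_class (G Mod core_in G M (carrier G)) F" "H \<subseteq> M"
proof -
  obtain n C where C: "C 0 = H" "C n = carrier G"
    and st: "\<And>i. i < n \<Longrightarrow> maximal_subgroup (C i) (G\<lparr>carrier := C (Suc i)\<rparr>) \<and>
               in_class (G\<lparr>carrier := C (Suc i)\<rparr> Mod core_in G (C i) (C (Suc i))) F"
    using H unfolding F_subnormal_def by blast
  \<comment> \<open>A proper \<open>H\<close> rules out the chain of length 0, so there is a last
    link, and its lower end is the maximal subgroup sought.\<close>
  have n: "n \<noteq> 0" using C H(2) by metis
  then obtain m where m: "n = Suc m" using not0_implies_Suc by blast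
  have mono: "C 0 \<subseteq> C i" if "i \<le> n" for i
    using that
  proof (induction i)
    case (Suc i)
    then have "C i \<subseteq> C (Suc i)" using st[of i] subgroup.subset[of "C i" "G\<lparr>carrier := C (Suc i)\<rparr>"]
      by (auto simp: maximal_subgroup_def)
    then show ?case using Suc by auto
  qed simp
  have "maximal_subgroup (C m) G" "in_class (G Mod core_in G (C m) (carrier G)) F"
    using st[of m] m C(2) by auto
  then show ?thesis using that[of "C m"] mono[of m] m C(1) by auto
qed

text \<open>Otherwise \<open>M\<close> contains a Sylow subgroup for every prime, so |G| divides
  |M|.\<close>

lemma (in group) ex_primary_element_notin:
  assumes fin: "finite (carrier G)" and M: "subgroup M G" "M \<noteq> carrier G"
  obtains x p k where "x \<in> carrier G" "x \<notin> M" "prime (p::nat)" "ord x = p ^ k"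
proof (rule ccontr)
  assume no: "\<not> thesis"
  have o0: "order G \<noteq> 0" using fin order_gt_0_iff_finite by simp
  have "order G dvd card M"
  proof (rule multiplicity_le_imp_dvd)
    show "order G \<noteq> 0" by (rule o0)
    fix p :: nat assume p: "prime p"
    let ?a = "multiplicity p (order G)"
    obtain m where "order G = p ^ ?a * m" using multiplicity_dvd by (metis dvdE)
    then obtain Q where Q: "subgroup Q G" "card Q = p ^ ?a"
      using sylow_thm[OF p is_group _ fin] by blast
    have "Q \<subseteq> M"
    proof
      fix x assume x: "x \<in> Q"
      then have "ord x dvd p ^ ?a" using ord_dvd_card_subgroup[OF Q(1)] Q(2) by metis
      then obtain k where "ord x = p ^ k" using p by (auto simp: divides_primepow_nat)
      then show "x \<in> M" using no that[of x p k] p x subgroup.mem_carrier[OF Q(1)] by blast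
    qed
    then have "p ^ ?a dvd card M" using card_subgroup_dvd[OF Q(1) M(1)] Q(2) by simp
    moreover have "card M \<noteq> 0"
      using M(1) fin subgroup.finite_imp_card_positive by fastforce
    ultimately show "?a \<le> multiplicity p (card M)"
      using p by (intro multiplicity_geI) (auto simp: prime_nat_iff)
  qed
  moreover have "card M dvd order G" using lagrange[OF M(1)] by (metis dvd_triv_right)
  ultimately have "card M = card (carrier G)" by (simp add: dvd_antisym order_def)
  then show False using M subgroup.subset[OF M(1)] fin by (metis card_subset_eq)
qed

lemma (in group) generate_primary_cyclic:
  assumes x: "x \<in> carrier G" "x \<noteq> \<one>" and p: "prime p" "ord x = p ^ k"
  shows "primary_subgroup (generate G {x}) G" "cyclic_group (G\<lparr>carrier := generate G {x}\<rparr>)"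
proof -
  have sub: "subgroup (generate G {x}) G" using x by (intro generate_is_subgroup) auto
  have "card (generate G {x}) = p ^ k" using generate_pow_card[OF x(1)] p(2) by simp
  moreover have "k \<noteq> 0" using x p(2) ord_eq_1[OF x(1)] by auto
  ultimately show "primary_subgroup (generate G {x}) G"
    using sub p(1) unfolding primary_subgroup_def by (metis One_nat_def Suc_leI neq0_conv)
  have "subgroup_generated G {x} = G\<lparr>carrier := generate G {x}\<rparr>"
    using x by (simp add: subgroup_generated_def)
  then show "cyclic_group (G\<lparr>carrier := generate G {x}\<rparr>)" using cyclic_group_generated[of x] by simp
qed

section \<open>A criterion for membership by primary cyclic subgroups\<close>

locale superradical_formation = subgroup_closed_formation +
  assumes superradical: "superradical F"
begin

text \<open>Superradicality quantifies over groups on \<open>nat\<close>, so the factorization is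
  moved to a copy of \<open>G\<close>. The witnessing homomorphisms are pulled back along the
  inverse isomorphism, and each factor then reaches the top in a single step.\<close>

lemma in_class_product:
  assumes G: "group G" and fin: "finite (carrier G)" and A: "subgroup A G" and B: "subgroup B G"
    and AB: "carrier G = A <#>\<^bsub>G\<^esub> B" and kA: "kernel_below F A G" and kB: "kernel_below F B G"
    and cA: "in_class (G\<lparr>carrier := A\<rparr>) F" and cB: "in_class (G\<lparr>carrier := B\<rparr>) F"
  shows "in_class G F"
proof -
  interpret G: group G by (rule G)
  obtain K :: "nat monoid" where K: "group K" "finite (carrier K)" "G \<cong> K"
    using G.ex_nat_copy[OF fin] by blast
  obtain f where f: "f \<in> iso G K" using K(3) by (auto simp: is_iso_def)
  let ?g = "inv_into (carrier G) f"
  have g: "?g \<in> iso K G" by (rule G.iso_set_sym[OF f])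
  have inj: "inj_on f (carrier G)" and surj: "f ` carrier G = carrier K" and hom: "f \<in> hom G K"
    using f by (auto simp: Group.iso_iff)
  interpret K: group K by (rule K(1))
  have transport: "subgroup (f ` U) K \<and> F_subnormal F (f ` U) K \<and> in_class (K\<lparr>carrier := f ` U\<rparr>) F"
    if U: "subgroup U G" and k: "kernel_below F U G" and c: "in_class (G\<lparr>carrier := U\<rparr>) F" for U
  proof (intro conjI)
    show s: "subgroup (f ` U) K" by (rule subgroup.iso_subgroup[OF U G K(1) f])
    obtain L h where L: "L \<in> F" and h: "h \<in> hom G L" "kernel G L h \<subseteq> U" using k by (auto simp: kernel_below_def)
    have "h \<circ> ?g \<in> hom K L" using g h(1) by (meson Group.hom_compose Group.iso_iff)
    moreover have "kernel K L (h \<circ> ?g) \<subseteq> f ` U"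
    proof
      fix y assume "y \<in> kernel K L (h \<circ> ?g)"
      then have y: "y \<in> carrier K" "h (?g y) = \<one>\<^bsub>L\<^esub>" by (auto simp: kernel_def)
      then have "?g y \<in> carrier G" "f (?g y) = y" using surj by (auto simp: inv_into_into f_inv_into_f)
      then show "y \<in> f ` U" using y h(2) by (auto simp: kernel_def intro!: image_eqI[of y f "?g y"])
    qed
    ultimately have "kernel_below F (f ` U) K" using L unfolding kernel_below_def by blast
    then have "(f ` U, carrier K) \<in> subnormal_step F K"
      using s K.subgroup_self subgroup.subset[OF s] by (simp add: subnormal_step_def)
    then show "F_subnormal F (f ` U) K" using F_subnormal_iff_steps[OF K(1,2)] by blast
    have "G\<lparr>carrier := U\<rparr> \<cong> K\<lparr>carrier := f ` U\<rparr>" using iso_restrict[OF f G K(1) U] by (rule is_isoI)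
    then have "K\<lparr>carrier := f ` U\<rparr> \<cong> G\<lparr>carrier := U\<rparr>"
      by (rule group.iso_sym[OF G.subgroup_imp_group[OF U]])
    then show "in_class (K\<lparr>carrier := f ` U\<rparr>) F" by (rule in_class_iso[OF c K.subgroup_imp_group[OF s]])
  qed
  have "carrier K = f ` A <#>\<^bsub>K\<^esub> f ` B"
    using set_mult_hom[OF hom subgroup.subset[OF A] subgroup.subset[OF B]] AB surj by simp
  then have "K \<in> F"
    using superradical K(1,2) transport[OF A kA cA] transport[OF B kB cB]
    unfolding superradical_def by blast
  then show ?thesis using K(3) G unfolding in_class_def by blast
qed

text \<open>The induction runs over the subgroups of one fixed \<open>G\<close>. The hypothesis then
  stays with \<open>G\<close>, and \<open>F_subnormal_Int\<close> brings it to each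
  \<open>S\<close>.\<close>

lemma in_class_if_primary_cyclic_F_subnormal:
  assumes G: "group G" and fin: "finite (carrier G)" and sol: "solvable G"
    and prim: "\<And>H. primary_subgroup H G \<Longrightarrow> cyclic_group (G\<lparr>carrier := H\<rparr>) \<Longrightarrow> F_subnormal F H G"
    and S: "subgroup S G"
  shows "in_class (G\<lparr>carrier := S\<rparr>) F"
  using S
proof (induction "card S" arbitrary: S rule: less_induct)
  case (less S)
  interpret G: group G by (rule G)
  note S = less.prems
  let ?S = "G\<lparr>carrier := S\<rparr>"
  interpret S: group ?S by (rule G.subgroup_imp_group[OF S])
  have SG: "S \<subseteq> carrier G" using S by (rule subgroup.subset)
  have finS: "finite S" using SG fin finite_subset by blast
  show ?case
  proof (cases "comm_group ?S")
    case True
    then show ?thesis by (rule in_class_abelian) (simp add: finS)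
  next
    case False
    have solS: "solvable ?S"
      using group_hom.inj_hom_imp_solvable[OF G.canonical_inj_is_hom[OF S]] sol by simp
    \<comment> \<open>A soluble perfect group has a constant derived series ending in 1, so it is
      trivial and thereby abelian.\<close>
    have "derived ?S (carrier ?S) \<noteq> carrier ?S"
    proof
      assume eq: "derived ?S (carrier ?S) = carrier ?S"
      have "(derived ?S ^^ n) (carrier ?S) = carrier ?S" for n
        by (induction n) (use eq in auto)
      then have "carrier ?S = {\<one>\<^bsub>?S\<^esub>}" using solS S.solvable_iff_trivial_derived_seq by auto
      then have "comm_group ?S" by (intro S.group_comm_groupI) auto
      then show False using False by blast
    qed
    then obtain M where M: "maximal_subgroup M ?S" "derived ?S (carrier ?S) \<subseteq> M"
      using ex_maximal_subgroup[OF _ S.derived_is_subgroup[OF subset_refl]] finS by auto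
    have Ms: "subgroup M ?S" "M \<noteq> carrier ?S" using M(1) by (auto simp: maximal_subgroup_def)
    have Mn: "M \<lhd> ?S" by (rule S.normal_if_derived_subset[OF Ms(1) M(2)])
    obtain x p k where x: "x \<in> carrier ?S" "x \<notin> M" and p: "prime (p::nat)" "S.ord x = p ^ k"
      using S.ex_primary_element_notin[OF _ Ms] finS by auto
    have xn1: "x \<noteq> \<one>\<^bsub>?S\<^esub>" using x(2) subgroup.one_closed[OF Ms(1)] by blast
    let ?H = "generate ?S {x}"
    have H: "subgroup ?H ?S" using x by (intro S.generate_is_subgroup) auto
    have xH: "x \<in> ?H" by (rule generate.incl) simp
    have HS: "?H \<subseteq> S" using subgroup.subset[OF H] by simp
    have "primary_subgroup ?H G" "cyclic_group (G\<lparr>carrier := ?H\<rparr>)"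
      using S.generate_primary_cyclic[OF x(1) xn1 p] G.incl_subgroup[OF S H]
      by (auto simp: primary_subgroup_def)
    then have "F_subnormal F ?H G" by (rule prim)
    from F_subnormal_Int[OF G fin S this]
    have sn: "F_subnormal F ?H ?S" using HS by (simp add: Int_absorb2)
    \<comment> \<open>A cyclic \<open>S\<close> would be abelian. So the chain from
      \<open>?H\<close> has a last proper term \<open>K\<close>.\<close>
    have "?H \<noteq> carrier ?S"
    proof
      assume "?H = carrier ?S"
      then have "?S\<lparr>carrier := ?H\<rparr> = ?S" by simp
      then have "cyclic_group ?S" using S.generate_primary_cyclic(2)[OF x(1) xn1 p] by metis
      then show False using S.cyclic_imp_abelian_group False by blast
    qed
    then obtain K where K: "maximal_subgroup K ?S" "in_class (?S Mod core_in ?S K (carrier ?S)) F" "?H \<subseteq> K"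
      using F_subnormal_imp_maximal[OF sn _ S.is_group] by blast
    have Ks: "subgroup K ?S" "K \<noteq> carrier ?S" using K(1) by (auto simp: maximal_subgroup_def)
    have MS: "M \<subset> S" "K \<subset> S" using Ms Ks subgroup.subset[OF Ms(1)] subgroup.subset[OF Ks(1)] by auto
    have cM: "in_class (?S\<lparr>carrier := M\<rparr>) F"
      using less.hyps[OF psubset_card_mono[OF finS MS(1)] G.incl_subgroup[OF S Ms(1)]] by simp
    have cK: "in_class (?S\<lparr>carrier := K\<rparr>) F"
      using less.hyps[OF psubset_card_mono[OF finS MS(2)] G.incl_subgroup[OF S Ks(1)]] by simp
    have kK: "kernel_below F K ?S" using in_class_core_iff[OF S.is_group Ks(1)] K(2) by blast
    have kM: "kernel_below F M ?S"
      by (rule kernel_below_if_derived_subset[OF S.is_group _ M(2)]) (simp add: finS)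
    have MK: "subgroup (M <#>\<^bsub>?S\<^esub> K) ?S" by (rule S.mult_norm_subgroup[OF Mn Ks(1)])
    have "M \<subseteq> M <#>\<^bsub>?S\<^esub> K" 
      by (rule S.subset_set_mult_left[OF subgroup.subset[OF Ms(1)] subgroup.one_closed[OF Ks(1)]])
    moreover have "x \<in> M <#>\<^bsub>?S\<^esub> K"
      using S.subset_set_mult_right[OF subgroup.subset[OF Ks(1)] subgroup.one_closed[OF Ms(1)]] xH K(3)
      by blast
    \<comment> \<open>The product contains \<open>M\<close> and also \<open>x\<close>, which is
      outside \<open>M\<close>, so maximality of \<open>M\<close> makes it all of
      \<open>S\<close>.\<close>
    ultimately have "M <#>\<^bsub>?S\<^esub> K = carrier ?S"
      using M(1) MK x(2) unfolding maximal_subgroup_def by blast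
    then show ?thesis
      using in_class_product[OF S.is_group _ Ms(1) Ks(1) _ kM kK cM cK] finS by simp
  qed
qed

end

section \<open>Lower central series and the nilpotent residual\<close>

lemma (in group) lower_central_subset: "lower_central G n \<subseteq> carrier G"
proof (induction n)
  case (Suc n)
  have "x \<otimes> y \<otimes> inv x \<otimes> inv y \<in> carrier G" if "x \<in> lower_central G n" "y \<in> carrier G" for x y
    using subsetD[OF Suc that(1)] that(2) by simp
  then have "(\<Union>x\<in>lower_central G n. \<Union>y\<in>carrier G. {x \<otimes> y \<otimes> inv x \<otimes> inv y}) \<subseteq> carrier G"
    by blast
  then show ?case unfolding lower_central.simps by (rule generate_incl)
qed simp

lemma (in group_hom) lower_central_img: "h ` lower_central G n \<subseteq> lower_central H n"
proof (induction n)
  case (Suc n)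
  let ?S = "\<Union>x\<in>lower_central G n. \<Union>y\<in>carrier G. {x \<otimes> y \<otimes> inv x \<otimes> inv y}"
  let ?T = "\<Union>x\<in>lower_central H n. \<Union>y\<in>carrier H. {x \<otimes>\<^bsub>H\<^esub> y \<otimes>\<^bsub>H\<^esub> inv\<^bsub>H\<^esub> x \<otimes>\<^bsub>H\<^esub> inv\<^bsub>H\<^esub> y}"
  have SG: "?S \<subseteq> carrier G" using G.lower_central_subset[of n] by auto
  have "h ` ?S \<subseteq> ?T"
  proof
    fix z assume "z \<in> h ` ?S"
    then obtain x y where xy: "x \<in> lower_central G n" "y \<in> carrier G"
        "z = h (x \<otimes> y \<otimes> inv x \<otimes> inv y)" by blast
    then have xG: "x \<in> carrier G" using G.lower_central_subset by blast
    have "z = h x \<otimes>\<^bsub>H\<^esub> h y \<otimes>\<^bsub>H\<^esub> inv\<^bsub>H\<^esub> h x \<otimes>\<^bsub>H\<^esub> inv\<^bsub>H\<^esub> h y" using xy xG by simp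
    moreover have "h x \<in> lower_central H n" "h y \<in> carrier H" using Suc xy by auto
    ultimately show "z \<in> ?T" by blast
  qed
  then have "generate H (h ` ?S) \<subseteq> generate H ?T" by (rule H.mono_generate)
  then show ?case using generate_img[OF SG] by simp
qed auto

text \<open>Take the least i whose term lies in \<open>H\<close>. If i = j + 1, commutators of the
  j-th term with \<open>H\<close> lie in \<open>H\<close>, so that term normalizes \<open>H\<close>
  and already lies in it.\<close>

lemma (in group) self_normalizing_contains_lower_central:
  assumes fin: "finite (carrier G)" and H: "self_normalizing H G" and n: "lower_central G n \<subseteq> H"
  shows "H = carrier G"
proof -
  have sub: "subgroup H G" and N: "normalizer G H = H" using H by (auto simp: self_normalizing_def)
  define i where "i = (LEAST i. lower_central G i \<subseteq> H)"
  have i: "lower_central G i \<subseteq> H" unfolding i_def using n by (rule LeastI)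
  have "i = 0"
  proof (rule ccontr)
    assume "i \<noteq> 0"
    then obtain j where j: "i = Suc j" using not0_implies_Suc by blast
    then have "\<not> lower_central G j \<subseteq> H"
      using not_less_Least[of j "\<lambda>i. lower_central G i \<subseteq> H"] by (simp add: i_def)
    then obtain g where g: "g \<in> lower_central G j" "g \<notin> H" by blast
    have gG: "g \<in> carrier G" using g lower_central_subset by blast
    have "g \<otimes> h \<otimes> inv g \<in> H" if h: "h \<in> H" for h
    proof -
      have hG: "h \<in> carrier G" using subgroup.mem_carrier[OF sub h] .
      have "g \<otimes> h \<otimes> inv g \<otimes> inv h \<in> lower_central G i"
        unfolding j lower_central.simps(2) by (rule generate.incl) (use g hG in blast)
      then have "g \<otimes> h \<otimes> inv g \<otimes> inv h \<otimes> h \<in> H" using i h subgroup.m_closed[OF sub] by blast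
      then show ?thesis using gG hG by (simp add: m_assoc)
    qed
    then have "g \<in> H" using mem_normalizer_iff[OF fin sub] N gG by blast
    then show False using g by blast
  qed
  then show ?thesis using i subgroup.subset[OF sub] by simp
qed

lemma (in group) derived_eq_nilpotent_residual:
  fixes p :: nat
  assumes fin: "finite (carrier G)" and p: "prime p"
    and P: "subgroup P G" "card P = p ^ n" and N: "normalizer G P = P"
    and ab: "\<And>a b. a \<in> P \<Longrightarrow> b \<in> P \<Longrightarrow> a \<otimes> b = b \<otimes> a"
  shows "derived G (carrier G) = residual nilpotent_class G"
proof
  have "in_class (G Mod derived G (carrier G)) nilpotent_class"
    by (rule abelian_in_nilpotent_class[OF derived_quot_is_comm_group])
      (use fin in \<open>simp add: carrier_FactGroup\<close>)
  then show "residual nilpotent_class G \<subseteq> derived G (carrier G)"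
    using derived_self_is_normal unfolding residual_def by blast
  show "derived G (carrier G) \<subseteq> residual nilpotent_class G"
    unfolding residual_def
  proof (rule Inter_greatest, clarify)
    fix M d assume M: "M \<lhd> G" and c: "in_class (G Mod M) nilpotent_class" and d: "d \<in> derived G (carrier G)"
    interpret M: normal M G by (rule M)
    have PG: "P \<subseteq> carrier G" using P(1) by (rule subgroup.subset)
    obtain K f where K: "K \<in> nilpotent_class" and f: "f \<in> iso (G Mod M) K"
      using c by (auto simp: in_class_def is_iso_def)
    have gK: "group K" using K by (simp add: nilpotent_class_def nilpotent_group_def)
    interpret f: group_hom "G Mod M" K f
      using f gK M.factorgroup_is_group by (simp add: group_hom_def group_hom_axioms_def Group.iso_iff)
    interpret q: group_hom G "G Mod M" "\<lambda>a. M #> a"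
      unfolding group_hom_def group_hom_axioms_def
      by (simp add: M.factorgroup_is_group M.r_coset_hom_Mod)
    obtain k where k: "lower_central K k = {\<one>\<^bsub>K\<^esub>}"
      using K by (auto simp: nilpotent_class_def nilpotent_group_def)
    \<comment> \<open>Terms of the series map into the corresponding terms of G/M and then of
      \<open>K\<close>, where the k-th one is trivial.\<close>
    have "lower_central G k \<subseteq> M"
    proof
      fix x assume x: "x \<in> lower_central G k"
      have xG: "x \<in> carrier G" using x lower_central_subset by blast
      have "M #> x \<in> lower_central (G Mod M) k" using q.lower_central_img[of k] x by blast
      then have "f (M #> x) \<in> lower_central K k" using f.lower_central_img[of k] by blast
      then have "f (M #> x) = \<one>\<^bsub>K\<^esub>" unfolding k by (rule singletonD)
      then have "f (M #> x) = f \<one>\<^bsub>G Mod M\<^esub>" by (simp only: f.hom_one)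
      moreover have "M #> x \<in> carrier (G Mod M)" using xG q.hom_closed by blast
      ultimately have "M #> x = \<one>\<^bsub>G Mod M\<^esub>"
        using f f.G.one_closed by (meson Group.iso_iff inj_onD)
      then have "M #> x = M" by simp
      then show "x \<in> M" using coset_join1 xG M.subgroup_axioms by blast
    qed
    moreover have s: "subgroup (M <#> P) G" by (rule mult_norm_subgroup[OF M P(1)])
    moreover have "M \<subseteq> M <#> P" 
      by (rule subset_set_mult_left[OF M.subset subgroup.one_closed[OF P(1)]])
    moreover have "P \<subseteq> M <#> P" by (rule subset_set_mult_right[OF PG M.one_closed])
    then have "p ^ n dvd card (M <#> P)" using card_subgroup_dvd[OF P(1) s] P(2) by simp
    then have "self_normalizing (M <#> P) G"
      using abnormal_imp_self_normalizing[OF fin]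
        abnormal_if_contains_self_normalizing_p_subgroup[OF fin p P N s] by blast
    \<comment> \<open>Thus \<open>P\<close> covers G/M, and a nilpotent quotient turns out to be
      abelian.\<close>
    ultimately have "M <#> P = carrier G"
      using self_normalizing_contains_lower_central[OF fin] by blast
    then show "d \<in> M" using derived_subset_if_abelian_supplement[OF M P(1) _ ab] d by blast
  qed
qed

section \<open>The implications (1) to (3) and (3) to (2)\<close>

context superradical_formation
begin

lemma kernel_below_if_in_class:
  assumes V: "in_class V F" and one: "\<one>\<^bsub>V\<^esub> \<in> U"
  shows "kernel_below F U V"
proof -
  obtain K f where K: "K \<in> F" and f: "f \<in> iso V K" and g: "group V"
    using V by (auto simp: in_class_def is_iso_def)
  then have "kernel V K f = {\<one>\<^bsub>V\<^esub>}" using iso_kernel_image[OF g group_mem[OF K]] by blast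
  then show ?thesis 
    using K f one unfolding kernel_below_def Group.iso_iff
    by (intro bexI[of _ K] bexI[of _ f]) simp_all
qed

lemma ex_generator_if_primary_cyclic:
  assumes G: "group G" and H: "primary_subgroup H G" "cyclic_group (G\<lparr>carrier := H\<rparr>)"
  obtains x p n where "x \<in> carrier G" "H = generate G {x}" "prime (p::nat)" "1 \<le> n" "card H = p ^ n"
    "subgroup H G" "comm_group (G\<lparr>carrier := H\<rparr>)"
proof -
  interpret G: group G by (rule G)
  have s: "subgroup H G" using H(1) by (simp add: primary_subgroup_def)
  interpret H: group "G\<lparr>carrier := H\<rparr>" by (rule G.subgroup_imp_group[OF s])
  obtain x where x: "x \<in> H" "subgroup_generated (G\<lparr>carrier := H\<rparr>) {x} = G\<lparr>carrier := H\<rparr>"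
    using H(2) by (auto simp: cyclic_group_def)
  have "carrier (subgroup_generated (G\<lparr>carrier := H\<rparr>) {x}) = H" by (simp add: x(2))
  then have "generate (G\<lparr>carrier := H\<rparr>) {x} = H" using x(1) by (simp add: carrier_subgroup_generated)
  then have "H = generate G {x}" using G.generate_consistent[OF _ s] x(1) by simp
  moreover have "x \<in> carrier G" using x(1) s by (rule subgroup.mem_carrier[rotated])
  moreover have "comm_group (G\<lparr>carrier := H\<rparr>)" using H(2) by (rule H.cyclic_imp_abelian_group)
  ultimately show ?thesis using that H(1) s unfolding primary_subgroup_def by blast
qed

lemma split_if_primary_cyclic_F_subnormal_or_self_normalizing:
  assumes G: "group G" and fin: "finite (carrier G)" and sol: "solvable G" and not: "\<not> in_class G F"
    and prim: "\<And>H. primary_subgroup H G \<Longrightarrow> cyclic_group (G\<lparr>carrier := H\<rparr>) \<Longrightarrow>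
       F_subnormal F H G \<or> self_normalizing H G"
  obtains x p where "x \<in> carrier G" "p \<in> prime_factors (order G)"
    "semidirect G (derived G (carrier G)) (generate G {x})"
    "sylow_subgroup p (generate G {x}) G"
    "carter_subgroup (generate G {x}) G"
    "derived G (carrier G) = residual nilpotent_class G"
    "semidirect (G\<lparr>carrier := derived G (carrier G) <#>\<^bsub>G\<^esub> generate G {x [^]\<^bsub>G\<^esub> p}\<rparr>)
       (derived G (carrier G)) (generate G {x [^]\<^bsub>G\<^esub> p})"
    "in_class (G\<lparr>carrier := derived G (carrier G) <#>\<^bsub>G\<^esub> generate G {x [^]\<^bsub>G\<^esub> p}\<rparr>) F"
proof -
  interpret G: group G by (rule G)
  let ?D = "derived G (carrier G)"
  have D: "?D \<lhd> G" by (rule G.derived_self_is_normal)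
  have Ds: "subgroup ?D G" using D by (rule normal_imp_subgroup)
  have abel: "a \<otimes>\<^bsub>G\<^esub> b = b \<otimes>\<^bsub>G\<^esub> a" if "comm_group (G\<lparr>carrier := H\<rparr>)" "a \<in> H" "b \<in> H" for a b H
    using comm_groupE(4)[OF that(1), of a b] that by simp
  obtain P where P: "primary_subgroup P G" "cyclic_group (G\<lparr>carrier := P\<rparr>)" "\<not> F_subnormal F P G"
    using in_class_if_primary_cyclic_F_subnormal[OF G fin sol _ G.subgroup_self] not by auto
  then have sn: "self_normalizing P G" using prim by blast
  then have N: "normalizer G P = P" by (simp add: self_normalizing_def)
  obtain x p n where x: "x \<in> carrier G" "P = generate G {x}" and p: "prime (p::nat)" and n: "1 \<le> n" "card P = p ^ n"
    and Ps: "subgroup P G" and ab: "comm_group (G\<lparr>carrier := P\<rparr>)"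
    using ex_generator_if_primary_cyclic[OF G P(1,2)] by blast
  have nd: "\<not> p ^ Suc n dvd order G" by (rule G.self_normalizing_p_subgroup_index[OF fin p Ps n(2) N])
  have pn: "p ^ n dvd order G" using G.lagrange[OF Ps] n(2) by (metis dvd_triv_right)
  have o0: "order G \<noteq> 0" using fin G.order_gt_0_iff_finite by simp
  have "p dvd p ^ n" using n by simp
  then have pf: "p \<in> prime_factors (order G)"
    using p pn o0 dvd_trans by (metis in_prime_factors_iff)
  have semi: "semidirect G ?D P"
    by (rule G.derived_complement_of_self_normalizing[OF fin sol p Ps n(2) N abel[OF ab]])
  then have DP: "?D \<inter> P = {\<one>\<^bsub>G\<^esub>}" by (simp add: semidirect_def)
  have "multiplicity p (order G) = n" by (rule multiplicity_eqI[OF pn nd])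
  then have syl: "sylow_subgroup p P G" using p Ps n by (simp add: sylow_subgroup_def)
  have car: "carter_subgroup P G" using sn comm_group.nilpotent[OF ab] by (simp add: carter_subgroup_def)
  have res: "?D = residual nilpotent_class G"
    by (rule G.derived_eq_nilpotent_residual[OF fin p Ps n(2) N abel[OF ab]])
  let ?Y = "generate G {x [^]\<^bsub>G\<^esub> p}"
  let ?M = "?D <#>\<^bsub>G\<^esub> ?Y"
  have Y: "subgroup ?Y G" using x(1) by (intro G.generate_is_subgroup) auto
  have xP: "x \<in> P" unfolding x(2) by (rule generate.incl) simp
  have "x [^]\<^bsub>G\<^esub> p \<in> P" using G.subgroup_int_pow_closed[OF Ps xP, of "int p"] by (simp only: int_pow_int)
  then have YP: "?Y \<subseteq> P" by (intro G.generate_subgroup_incl[OF _ Ps]) auto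
  have M: "subgroup ?M G" by (rule G.mult_norm_subgroup[OF D Y])
  have DM: "?D \<subseteq> ?M" 
    by (rule G.subset_set_mult_left[OF subgroup.subset[OF Ds] subgroup.one_closed[OF Y]])
  have YM: "?Y \<subseteq> ?M" 
    by (rule G.subset_set_mult_right[OF subgroup.subset[OF Y] subgroup.one_closed[OF Ds]])
  have semiM: "semidirect (G\<lparr>carrier := ?M\<rparr>) ?D ?Y"
    unfolding semidirect_def
  proof (intro conjI)
    show "?D \<lhd> G\<lparr>carrier := ?M\<rparr>" by (rule G.normal_restrict_supergroup[OF M D DM])
    show "subgroup ?Y (G\<lparr>carrier := ?M\<rparr>)" by (rule G.subgroup_incl[OF Y M YM])
    show "?D \<inter> ?Y = {\<one>\<^bsub>G\<lparr>carrier := ?M\<rparr>\<^esub>}"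
      using DP YP subgroup.one_closed[OF Y] subgroup.one_closed[OF Ds] by auto
  qed simp
  \<comment> \<open>If x = dy, then d lies in both \<open>?D\<close> and \<open>P\<close>, so d = 1
    and x lies in <x^p>. The two generators would then have equal orders, although p divides the
    order of x.\<close>
  have xM: "x \<notin> ?M"
  proof
    assume "x \<in> ?M"
    then obtain d y where dy: "d \<in> ?D" "y \<in> ?Y" "x = d \<otimes>\<^bsub>G\<^esub> y" by (auto simp: set_mult_def)
    have dG: "d \<in> carrier G" and yG: "y \<in> carrier G"
      using subgroup.mem_carrier[OF Ds dy(1)] subgroup.mem_carrier[OF Y dy(2)] .
    have "d = x \<otimes>\<^bsub>G\<^esub> inv\<^bsub>G\<^esub> y" using dy(3) dG yG by (simp add: G.m_assoc)
    then have "d \<in> P" using xP dy(2) YP Ps by (metis subgroup.m_closed subgroup.m_inv_closed subsetD)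
    then have "d = \<one>\<^bsub>G\<^esub>" using DP dy(1) by blast
    then have "x \<in> ?Y" using dy yG by simp
    then have "P \<subseteq> ?Y" unfolding x(2) by (intro G.generate_subgroup_incl[OF _ Y]) auto
    then have "P = ?Y" using YP by blast
    then have "G.ord (x [^]\<^bsub>G\<^esub> p) = G.ord x"
      using G.generate_pow_card[of x] G.generate_pow_card[of "x [^]\<^bsub>G\<^esub> p"] x by simp
    moreover have ox: "G.ord x = p ^ n" using G.generate_pow_card[of x] x n by simp
    moreover have "G.ord (x [^]\<^bsub>G\<^esub> p) = p ^ n div p"
      using G.ord_pow[OF x(1), of p] ox \<open>p dvd p ^ n\<close> p by (simp add: prime_gt_0_nat)
    ultimately have "p ^ n div p = p ^ n" by simp
    then show False using prime_gt_1_nat[OF p] by (simp add: div_eq_dividend_iff)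
  qed
  \<comment> \<open>\<open>?M\<close> is both the ambient group and the subgroup in the criterion,
    hence the doubled update.\<close>
  have "in_class ((G\<lparr>carrier := ?M\<rparr>)\<lparr>carrier := ?M\<rparr>) F"
  proof (rule in_class_if_primary_cyclic_F_subnormal)
    interpret M: group "G\<lparr>carrier := ?M\<rparr>" by (rule G.subgroup_imp_group[OF M])
    show "group (G\<lparr>carrier := ?M\<rparr>)" by (rule M.is_group)
    show "finite (carrier (G\<lparr>carrier := ?M\<rparr>))" using subgroup.subset[OF M] fin finite_subset by auto
    show "solvable (G\<lparr>carrier := ?M\<rparr>)"
      using group_hom.inj_hom_imp_solvable[OF G.canonical_inj_is_hom[OF M]] sol by simp
    show "subgroup ?M (G\<lparr>carrier := ?M\<rparr>)" using M.subgroup_self by simp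
    fix H assume H: "primary_subgroup H (G\<lparr>carrier := ?M\<rparr>)" "cyclic_group (G\<lparr>carrier := ?M\<rparr>\<lparr>carrier := H\<rparr>)"
    then have HMs: "subgroup H (G\<lparr>carrier := ?M\<rparr>)" by (simp only: primary_subgroup_def)
    then have HM: "H \<subseteq> ?M" using subgroup.subset[OF HMs] by simp
    have H': "primary_subgroup H G" "cyclic_group (G\<lparr>carrier := H\<rparr>)"
      using H G.incl_subgroup[OF M HMs] by (simp_all add: primary_subgroup_def)
    \<comment> \<open>A self-normalizing \<open>H\<close> would be a complement of \<open>?D\<close>
      as well. With both \<open>?D\<close> and \<open>H\<close> inside \<open>?M\<close>, this puts
      \<open>x\<close> into \<open>?M\<close>.\<close>
    have "\<not> self_normalizing H G"
    proof
      assume snH: "self_normalizing H G"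
      obtain q m where q: "prime (q::nat)" and m: "card H = q ^ m"
        and Hs: "subgroup H G" and abH: "comm_group (G\<lparr>carrier := H\<rparr>)"
        using ex_generator_if_primary_cyclic[OF G H'] by blast
      have NH: "normalizer G H = H" using snH by (simp add: self_normalizing_def)
      have "semidirect G ?D H"
        by (rule G.derived_complement_of_self_normalizing[OF fin sol q Hs m NH abel[OF abH]])
      then have "x \<in> ?D <#>\<^bsub>G\<^esub> H" using x(1) by (simp add: semidirect_def)
      then obtain d h where "d \<in> ?D" "h \<in> H" "x = d \<otimes>\<^bsub>G\<^esub> h" unfolding set_mult_def by blast
      then have "x \<in> ?M" using subgroup.m_closed[OF M subsetD[OF DM] subsetD[OF HM]] by simp
      then show False using xM by blast
    qed
    then have "F_subnormal F H G" using prim[OF H'] by blast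
    from F_subnormal_Int[OF G fin M this] show "F_subnormal F H (G\<lparr>carrier := ?M\<rparr>)"
      using HM by (simp add: Int_absorb2)
  qed
  then have "in_class (G\<lparr>carrier := ?M\<rparr>) F" by simp
  then show ?thesis using that[OF x(1) pf] semi syl car res semiM unfolding x(2) by blast
qed

text \<open>The quotient by \<open>?D\<close> is cyclic of order |P|, and an element outside
  \<open>?M\<close> maps to a generator of it. Its order is then a multiple of |P|, so a subgroup
  containing it is abnormal.\<close>

lemma non_abnormal_F_subnormal_if_split:
  assumes G: "group G" and fin: "finite (carrier G)"
    and x: "x \<in> carrier G" and semi: "semidirect G (derived G (carrier G)) (generate G {x})"
    and syl: "sylow_subgroup p (generate G {x}) G"
    and car: "carter_subgroup (generate G {x}) G"
    and cM: "in_class (G\<lparr>carrier := derived G (carrier G) <#>\<^bsub>G\<^esub> generate G {x [^]\<^bsub>G\<^esub> p}\<rparr>) F"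
    and H: "subgroup H G" "\<not> abnormal H G"
  shows "F_subnormal F H G \<and> in_class (G\<lparr>carrier := H\<rparr>) F"
proof -
  interpret G: group G by (rule G)
  let ?D = "derived G (carrier G)" and ?P = "generate G {x}"
  let ?Y = "generate G {x [^]\<^bsub>G\<^esub> p}"
  let ?M = "?D <#>\<^bsub>G\<^esub> ?Y"
  have D: "?D \<lhd> G" by (rule G.derived_self_is_normal)
  have Ds: "subgroup ?D G" using D by (rule normal_imp_subgroup)
  have Y: "subgroup ?Y G" using x by (intro G.generate_is_subgroup) auto
  have M: "subgroup ?M G" by (rule G.mult_norm_subgroup[OF D Y])
  have DM: "?D \<subseteq> ?M" 
    by (rule G.subset_set_mult_left[OF subgroup.subset[OF Ds] subgroup.one_closed[OF Y]])
  define n where "n = multiplicity p (order G)"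
  have p: "prime p" and Ps: "subgroup ?P G" and n: "card ?P = p ^ n"
    using syl by (auto simp: sylow_subgroup_def n_def)
  have N: "normalizer G ?P = ?P" using car by (simp add: carter_subgroup_def self_normalizing_def)
  have DP: "?D \<inter> ?P = {\<one>\<^bsub>G\<^esub>}" and GDP: "carrier G = ?D <#>\<^bsub>G\<^esub> ?P" using semi by (auto simp: semidirect_def)
  have ox: "G.ord x = p ^ n" using G.generate_pow_card[OF x] n by simp
  interpret D: normal ?D G by (rule D)
  interpret q: group_hom G "G Mod ?D" "\<lambda>a. ?D #>\<^bsub>G\<^esub> a"
    unfolding group_hom_def group_hom_axioms_def
    by (simp add: D.factorgroup_is_group D.r_coset_hom_Mod)
  have HM: "H \<subseteq> ?M"
  proof
    fix h assume h: "h \<in> H"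
    have hG: "h \<in> carrier G" using subgroup.mem_carrier[OF H(1) h] .
    show "h \<in> ?M"
    proof (rule ccontr)
      assume hM: "h \<notin> ?M"
      have "h \<in> ?D <#>\<^bsub>G\<^esub> ?P" using hG GDP by simp
      then obtain d y where dy: "d \<in> ?D" "y \<in> ?P" "h = d \<otimes>\<^bsub>G\<^esub> y" unfolding set_mult_def by blast
      obtain i :: int where i: "y = x [^]\<^bsub>G\<^esub> i" using dy(2) G.generate_pow[OF x] by auto
      have yG: "y \<in> carrier G" using i x by simp
      \<comment> \<open>Modulo \<open>?D\<close>, \<open>h\<close> equals x^i; a multiple i of p
        would put \<open>y\<close> into <x^p>.\<close>
      have pi: "\<not> int p dvd i"
      proof
        assume "int p dvd i"
        then obtain j where "i = int p * j" by (auto elim: dvdE)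
        then have "y = (x [^]\<^bsub>G\<^esub> p) [^]\<^bsub>G\<^esub> j"
          using i x by (simp add: G.int_pow_pow[symmetric] int_pow_int)
        then have "y \<in> ?Y"
          using G.subgroup_int_pow_closed[OF Y generate.incl[of "x [^]\<^bsub>G\<^esub> p"]] by simp
        then have "h \<in> ?M" using dy unfolding set_mult_def by blast
        then show False using hM by blast
      qed
      let ?m = "G.ord h"
      have "h \<in> ?D #>\<^bsub>G\<^esub> y" using dy by (auto simp: r_coset_def)
      then have hy: "?D #>\<^bsub>G\<^esub> h = ?D #>\<^bsub>G\<^esub> y" using G.repr_independence[OF _ yG Ds] by simp
      \<comment> \<open>\<open>h\<close> and \<open>y\<close> agree modulo \<open>?D\<close>, so the
        power of \<open>y\<close> by the order of \<open>h\<close> lies in both \<open>?D\<close>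
        and \<open>?P\<close> and is trivial. As i is prime to p, the full order p^n of
        \<open>x\<close> divides the order of \<open>h\<close>.\<close>
      have "?D #>\<^bsub>G\<^esub> (y [^]\<^bsub>G\<^esub> ?m) = (?D #>\<^bsub>G\<^esub> h) [^]\<^bsub>G Mod ?D\<^esub> ?m"
        using q.hom_nat_pow[OF yG] hy by simp
      also have "\<dots> = ?D #>\<^bsub>G\<^esub> (h [^]\<^bsub>G\<^esub> ?m)" using q.hom_nat_pow[OF hG] by simp
      also have "\<dots> = ?D" using hG G.coset_mult_one[OF D.subset] by simp
      finally have "y [^]\<^bsub>G\<^esub> ?m \<in> ?D" using G.coset_join1[OF _ _ Ds] yG by blast
      moreover have "y [^]\<^bsub>G\<^esub> ?m \<in> ?P"
        using G.subgroup_int_pow_closed[OF Ps dy(2), of "int ?m"] by (simp only: int_pow_int)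
      ultimately have "y [^]\<^bsub>G\<^esub> ?m = \<one>\<^bsub>G\<^esub>" using DP by blast
      then have "x [^]\<^bsub>G\<^esub> (i * int ?m) = \<one>\<^bsub>G\<^esub>"
        using i x by (simp add: G.int_pow_pow[symmetric] int_pow_int)
      then have "int (p ^ n) dvd i * int ?m" using G.int_pow_eq_id[OF x] ox by metis
      moreover have "coprime (int (p ^ n)) i"
        using pi p by (simp add: prime_imp_coprime)
      ultimately have "int (p ^ n) dvd int ?m" by (simp add: coprime_dvd_mult_right_iff)
      then have "p ^ n dvd ?m" by (simp only: int_dvd_int_iff)
      then have "p ^ n dvd card H" using G.ord_dvd_card_subgroup[OF H(1) h] dvd_trans by blast
      then have "abnormal H G"
        by (rule G.abnormal_if_contains_self_normalizing_p_subgroup[OF fin p Ps n N H(1)])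
      then show False using H(2) by blast
    qed
  qed
  have HMs: "subgroup H (G\<lparr>carrier := ?M\<rparr>)" by (rule G.subgroup_incl[OF H(1) M HM])
  \<comment> \<open>An isomorphism of \<open>?M\<close> onto a member of \<open>F\<close> has
    trivial kernel, so every subgroup of \<open>?M\<close> is one step below it.\<close>
  have "kernel_below F H (G\<lparr>carrier := ?M\<rparr>)"
    by (rule kernel_below_if_in_class[OF cM]) (simp add: subgroup.one_closed[OF H(1)])
  then have "(H, ?M) \<in> subnormal_step F G" using H(1) M HM by (simp add: subnormal_step_def)
  moreover have "(?M, carrier G) \<in> subnormal_step F G"
    using M G.subgroup_self subgroup.subset[OF M] kernel_below_if_derived_subset[OF G fin DM]
    by (simp add: subnormal_step_def)
  ultimately have "F_subnormal F H G"
    unfolding F_subnormal_iff_steps[OF G fin] by (meson r_into_rtrancl rtrancl_trans)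
  moreover have "in_class (G\<lparr>carrier := H\<rparr>) F" using in_class_subgroup[OF cM HMs] by simp
  ultimately show ?thesis by blast
qed

end

theorem theorem3p1:
  fixes F :: "nat monoid set" and G :: "('a, 'b) monoid_scheme"
  assumes "formation F"
    and "subgroup_closed F"
    and "saturated F"
    and "superradical F"
    and "nilpotent_class \<subseteq> F"
    and "group G"
    and "finite (carrier G)"
    and "solvable G"
    and "\<not> in_class G F"
  shows
    "((\<forall>H. primary_subgroup H G \<and> cyclic_group (G\<lparr>carrier := H\<rparr>) \<longrightarrow>
         F_subnormal F H G \<or> self_normalizing H G)
      \<longleftrightarrow>
      (\<forall>H. subgroup H G \<and> \<not> abnormal H G \<longrightarrow>
         F_subnormal F H G \<and> in_class (G\<lparr>carrier := H\<rparr>) F))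
     \<and>
     ((\<forall>H. subgroup H G \<and> \<not> abnormal H G \<longrightarrow>
         F_subnormal F H G \<and> in_class (G\<lparr>carrier := H\<rparr>) F)
      \<longleftrightarrow>
      (\<exists>x\<in>carrier G. \<exists>p\<in>prime_factors (order G).
         semidirect G (derived G (carrier G)) (generate G {x}) \<and>
         sylow_subgroup p (generate G {x}) G \<and>
         carter_subgroup (generate G {x}) G \<and>
         derived G (carrier G) = residual nilpotent_class G \<and>
         semidirect (G\<lparr>carrier := derived G (carrier G) <#>\<^bsub>G\<^esub> generate G {x [^]\<^bsub>G\<^esub> p}\<rparr>)
           (derived G (carrier G)) (generate G {x [^]\<^bsub>G\<^esub> p}) \<and>
         in_class (G\<lparr>carrier := derived G (carrier G) <#>\<^bsub>G\<^esub> generate G {x [^]\<^bsub>G\<^esub> p}\<rparr>) F))"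
proof -
  interpret superradical_formation F
    using assms by unfold_locales
  note G = \<open>group G\<close> and fin = \<open>finite (carrier G)\<close>
  {
    assume prim: "\<forall>H. primary_subgroup H G \<and> cyclic_group (G\<lparr>carrier := H\<rparr>) \<longrightarrow>
         F_subnormal F H G \<or> self_normalizing H G"
    have "\<exists>x\<in>carrier G. \<exists>p\<in>prime_factors (order G).
         semidirect G (derived G (carrier G)) (generate G {x}) \<and>
         sylow_subgroup p (generate G {x}) G \<and>
         carter_subgroup (generate G {x}) G \<and>
         derived G (carrier G) = residual nilpotent_class G \<and>
         semidirect (G\<lparr>carrier := derived G (carrier G) <#>\<^bsub>G\<^esub> generate G {x [^]\<^bsub>G\<^esub> p}\<rparr>)
           (derived G (carrier G)) (generate G {x [^]\<^bsub>G\<^esub> p}) \<and>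
         in_class (G\<lparr>carrier := derived G (carrier G) <#>\<^bsub>G\<^esub> generate G {x [^]\<^bsub>G\<^esub> p}\<rparr>) F"
      (is "\<exists>x\<in>_. \<exists>p\<in>_. ?split x p")
    proof (rule split_if_primary_cyclic_F_subnormal_or_self_normalizing[OF G fin assms(8,9)])
      show "F_subnormal F H G \<or> self_normalizing H G"
        if "primary_subgroup H G" "cyclic_group (G\<lparr>carrier := H\<rparr>)" for H
        using prim that by blast
    qed (intro bexI conjI)
  }
  moreover
  {
    fix x p assume "x \<in> carrier G"
      "semidirect G (derived G (carrier G)) (generate G {x})"
      "sylow_subgroup p (generate G {x}) G" "carter_subgroup (generate G {x}) G"
      "in_class (G\<lparr>carrier := derived G (carrier G) <#>\<^bsub>G\<^esub> generate G {x [^]\<^bsub>G\<^esub> p}\<rparr>) F"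
    from non_abnormal_F_subnormal_if_split[OF G fin this]
    have "\<forall>H. subgroup H G \<and> \<not> abnormal H G \<longrightarrow> F_subnormal F H G \<and> in_class (G\<lparr>carrier := H\<rparr>) F"
      by blast
  }
  moreover
  {
    assume all: "\<forall>H. subgroup H G \<and> \<not> abnormal H G \<longrightarrow> F_subnormal F H G \<and> in_class (G\<lparr>carrier := H\<rparr>) F"
    have "F_subnormal F H G \<or> self_normalizing H G" if "primary_subgroup H G" for H
      using all that group.abnormal_imp_self_normalizing[OF G fin] unfolding primary_subgroup_def by blast
  }
  \<comment> \<open>The blocks form the cycle (1) to (3) to (2) to (1), which yields both
    equivalences.\<close>
  ultimately show ?thesis by meson
qed

end
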